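(* Let $N$ be a finite player set and let favors be substitutable. A network $g$ on $N$ is stable if and only if every link $ij\in g$ is sustainable at $g$.
   Context: Networks. $N=\{1,\dots,n\}$ is a finite set of players. A network $g$ is an undirected simple graph on $N$, viewed as its set of links; $N_i(g)=\{j: ij\in g\}$, $d_i(g)=|N_i(g)|$; $g-ij$ is $g$ with link $ij$ deleted. Parameters: $\alpha\in(0,1]$, $p\in(0,1)$, $\delta\in(0,1)$, $v>c>0$, $\gamma\in[0,c)$. Favor exchange game (substitutable favors). Time is $t=0,1,2,\dots$; $g_t$ is the network at the beginning of period $t$, and $g_0=g$ is common knowledge. In each period: (i) players decide, for each of their links, to keep ($K$) or remove ($R$) it (a link removed by either side disappears permanently); (ii) at most one player requires a favor, each given player requiring one with probability $\alpha$ (the type of favor is drawn uniformly from a finite set $F$); (iii) each other player is independently able to provide the favor in that period with probability $p$ (the same $p$ for all players and favor types: this is what "substitutable" means); (iv) if some current neighbors of the requester $i$ are able, one of them, $j$, is selected uniformly at random; (v) $j$ chooses $C$ (payoff $v$ to $i$, $-c$ to $j$) or $D$ (payoff $0$ to $i$, $-\gamma$ to $j$). All other payoffs are $0$. Players discount with factor $\delta$. Player $i$ observes with whom she plays, the action profiles in periods in which she plays, and her own neighborhood $N_i(g_t)$, but not $g_t$. Strategies and equilibrium. A strategy $\sigma_i(h_{t,i},j)$ gives, for each private history $h_{t,i}$ and each $j\ne i$, a probability distribution over $i$'s decisions toward $j$ ($K$ or $R$, and the action if playing with $j$). The bilateral history $h_{t,ij}$ contains only the periods and action profiles of all past interactions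 between $i$ and $j$. A profile $\sigma$ is measurable with respect to bilateral histories if $\sigma_i(h_{t,i},j)=\sigma_i(h'_{t,i},j)$ whenever $h_{t,ij}=h'_{t,ij}$, for all $i,j$. $(g,\sigma)$ is a bilateral equilibrium if $\sigma$ is measurable with respect to bilateral histories and there are beliefs $\mu$ such that $(\sigma,\mu)$ is a sequential equilibrium of the game with $g_0=g$ (each continuation strategy is optimal given beliefs at every private history, and beliefs are limits of Bayesian beliefs along a sequence of strategy profiles converging to $\sigma$). A bilateral equilibrium is stable if on the equilibrium path all favors are provided and all links are kept. A network $g$ is stable if there is $\sigma$ such that $(g,\sigma)$ is a stable bilateral equilibrium. Per-period payoff in $g$ when all favors are provided: $u_i(g)=\alpha v\big(1-(1-p)^{d_i(g)}\big)-\sum_{j\in N_i(g)}\alpha c\,\frac{1-(1-p)^{d_j(g)}}{d_j(g)}$. Sustainability. A link $ij$ is sustainable at $g$ if for both $x\in\{i,j\}$: $\frac{\delta}{1-\delta}u_x(g)-\frac{\delta}{1-\delta}u_x(g-ij)\ge c-\gamma$. *)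

theory Defs
  imports "HOL-Probability.Probability" "HOL-Probability.Product_PMF"
begin

text \<open>
  The players are the elements of a finite type \<open>'n\<close>; a network is its set of links, a link being a
  two-element set of players.
\<close>

definition network :: "'n set set \<Rightarrow> bool" where
  "network g \<longleftrightarrow> (\<forall>e\<in>g. card e = 2)"

definition neighbors :: "'n set set \<Rightarrow> 'n \<Rightarrow> 'n set" where
  "neighbors g i = {j. {i, j} \<in> g}"

definition deg :: "'n set set \<Rightarrow> 'n \<Rightarrow> nat" where
  "deg g i = card (neighbors g i)"

record 'f favor_params =
  req_prob :: real        \<comment> \<open>\<open>\<alpha>\<close>\<close>
  able_prob :: real       \<comment> \<open>\<open>p\<close>\<close>
  discount :: real        \<comment> \<open>\<open>\<delta>\<close>\<close>
  benefit :: real         \<comment> \<open>\<open>v\<close>\<close>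
  cost :: real            \<comment> \<open>\<open>c\<close>\<close>
  refusal_cost :: real    \<comment> \<open>\<open>\<gamma>\<close>\<close>
  favor_types :: "'f set" \<comment> \<open>\<open>F\<close>\<close>

text \<open>
  That at most one player requires a favor while each given player requires one with probability
  \<open>\<alpha>\<close> is only possible if \<open>n \<alpha> \<le> 1\<close>, where \<open>n\<close> is the number of players.
\<close>

definition valid_params :: "'n::finite itself \<Rightarrow> 'f favor_params \<Rightarrow> bool" where
  "valid_params _ P \<longleftrightarrow>
     0 < req_prob P \<and> req_prob P \<le> 1 \<and> real CARD('n) * req_prob P \<le> 1 \<and>
     0 < able_prob P \<and> able_prob P < 1 \<and>
     0 < discount P \<and> discount P < 1 \<and>
     0 < cost P \<and> cost P < benefit P \<and>
     0 \<le> refusal_cost P \<and> refusal_cost P < cost P \<and>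
     finite (favor_types P) \<and> favor_types P \<noteq> {}"

datatype link_choice = Keep | Remove

datatype action = Provide | Refuse  \<comment> \<open>\<open>C\<close> and \<open>D\<close>\<close>

text \<open>
  \<open>d (i, j)\<close> is the decision of \<open>i\<close> on her link with \<open>j\<close>; it is \<open>Keep\<close> by convention where there
  is no such link. \<open>Some (r, q, a)\<close> is an interaction in which \<open>r\<close> requires the favor and the
  selected player \<open>q\<close> chooses \<open>a\<close>. A history lists the past periods, oldest first.
\<close>

type_synonym 'n decisions = "'n \<times> 'n \<Rightarrow> link_choice"
type_synonym 'n interaction = "('n \<times> 'n \<times> action) option"
type_synonym 'n history = "('n decisions \<times> 'n interaction) list"

definition prune :: "'n set set \<Rightarrow> 'n decisions \<Rightarrow> 'n set set" where
  "prune g d = {{i, j} |i j. {i, j} \<in> g \<and> d (i, j) = Keep \<and> d (j, i) = Keep}"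

definition current_network :: "'n set set \<Rightarrow> 'n history \<Rightarrow> 'n set set" where
  "current_network g h = foldl (\<lambda>g' x. prune g' (fst x)) g h"

text \<open>
  A private history of \<open>i\<close> consists of, for each past period, her neighborhood at its beginning, her
  own link decisions (players have perfect recall) and the interaction if she took part in it,
  together with her current neighborhood.
\<close>

type_synonym 'n observation = "'n set \<times> ('n \<Rightarrow> link_choice) \<times> 'n interaction"
type_synonym 'n private_history = "'n observation list \<times> 'n set"

definition involving :: "'n \<Rightarrow> 'n interaction \<Rightarrow> 'n interaction" where
  "involving i m = (case m of None \<Rightarrow> None | Some (r, q, a) \<Rightarrow> if i = r \<or> i = q then m else None)"

definition private_history :: "'n set set \<Rightarrow> 'n \<Rightarrow> 'n history \<Rightarrow> 'n private_history" where
  "private_history g i h =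
     (map (\<lambda>s. (neighbors (current_network g (take s h)) i,
                \<lambda>j. fst (h ! s) (i, j),
                involving i (snd (h ! s)))) [0..<length h],
      neighbors (current_network g h) i)"

text \<open>
  The entry at position \<open>s\<close> is the interaction between the owner of the private history and \<open>j\<close> in
  period \<open>s\<close>, and \<open>None\<close> if there was none.
\<close>

definition bilateral_history :: "'n \<Rightarrow> 'n private_history \<Rightarrow> 'n interaction list" where
  "bilateral_history j I = map (\<lambda>(_, _, m). involving j m) (fst I)"

text \<open>
  \<open>\<sigma> i I j\<close> gives \<open>i\<close>'s (independent) randomizations over keeping or removing the link with \<open>j\<close>, and
  over the action to take if selected in the same period to do a favor to \<open>j\<close>.
\<close>

type_synonym 'n strategy = "'n private_history \<Rightarrow> 'n \<Rightarrow> link_choice pmf \<times> action pmf"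
type_synonym 'n profile = "'n \<Rightarrow> 'n strategy"

definition link_decisions :: "'n::finite set set \<Rightarrow> 'n profile \<Rightarrow> 'n history \<Rightarrow> 'n decisions pmf" where
  "link_decisions g \<sigma> h =
     Pi_pmf {(i, j). {i, j} \<in> current_network g h} Keep
       (\<lambda>(i, j). fst (\<sigma> i (private_history g i h) j))"

definition request :: "'f favor_params \<Rightarrow> ('n::finite \<times> 'f) option pmf" where
  "request P =
     bind_pmf (bernoulli_pmf (real CARD('n) * req_prob P))
       (\<lambda>b. if b then map_pmf Some (pair_pmf (pmf_of_set UNIV) (pmf_of_set (favor_types P)))
            else return_pmf None)"

text \<open>
  Favors being substitutable, ability depends neither on the player nor on the type \<open>f\<close>. The
  types are not observed, so histories do not record them.
\<close>

definition able_players :: "'f favor_params \<Rightarrow> 'n::finite \<Rightarrow> 'f \<Rightarrow> 'n set pmf" where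
  "able_players P i f =
     map_pmf Collect (Pi_pmf (UNIV - {i}) False (\<lambda>_. bernoulli_pmf (able_prob P)))"

definition matching :: "'f favor_params \<Rightarrow> 'n::finite set set \<Rightarrow> ('n \<times> 'n) option pmf" where
  "matching P g =
     bind_pmf (request P) (\<lambda>q. case q of
         None \<Rightarrow> return_pmf None
       | Some (i, f) \<Rightarrow> bind_pmf (able_players P i f) (\<lambda>A.
           if A \<inter> neighbors g i = {} then return_pmf None
           else map_pmf (\<lambda>j. Some (i, j)) (pmf_of_set (A \<inter> neighbors g i))))"

definition pre_action ::
  "'f favor_params \<Rightarrow> 'n::finite set set \<Rightarrow> 'n profile \<Rightarrow> 'n history
     \<Rightarrow> ('n decisions \<times> ('n \<times> 'n) option) pmf" where
  "pre_action P g \<sigma> h =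
     bind_pmf (link_decisions g \<sigma> h)
       (\<lambda>d. map_pmf (Pair d) (matching P (prune (current_network g h) d)))"

definition period ::
  "'f favor_params \<Rightarrow> 'n::finite set set \<Rightarrow> 'n profile \<Rightarrow> 'n history \<Rightarrow> 'n history pmf" where
  "period P g \<sigma> h =
     bind_pmf (pre_action P g \<sigma> h) (\<lambda>(d, m). case m of
         None \<Rightarrow> return_pmf (h @ [(d, None)])
       | Some (r, q) \<Rightarrow>
           map_pmf (\<lambda>a. h @ [(d, Some (r, q, a))]) (snd (\<sigma> q (private_history g q h) r)))"

fun play ::
  "'f favor_params \<Rightarrow> 'n::finite set set \<Rightarrow> 'n profile \<Rightarrow> 'n history \<Rightarrow> nat \<Rightarrow> 'n history pmf" where
  "play P g \<sigma> h 0 = return_pmf h"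
| "play P g \<sigma> h (Suc n) = bind_pmf (play P g \<sigma> h n) (period P g \<sigma>)"

definition feasible_decisions :: "'n set set \<Rightarrow> 'n history \<Rightarrow> 'n decisions \<Rightarrow> bool" where
  "feasible_decisions g h d \<longleftrightarrow> (\<forall>i j. {i, j} \<notin> current_network g h \<longrightarrow> d (i, j) = Keep)"

inductive_set histories :: "'f favor_params \<Rightarrow> 'n::finite set set \<Rightarrow> 'n history set"
  for P :: "'f favor_params" and g :: "'n set set" where
  initial: "[] \<in> histories P g"
| no_favor: "h \<in> histories P g \<Longrightarrow> feasible_decisions g h d \<Longrightarrow>
    None \<in> set_pmf (matching P (prune (current_network g h) d)) \<Longrightarrow>
    h @ [(d, None)] \<in> histories P g"
| favor: "h \<in> histories P g \<Longrightarrow> feasible_decisions g h d \<Longrightarrow>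
    Some (r, q) \<in> set_pmf (matching P (prune (current_network g h) d)) \<Longrightarrow>
    h @ [(d, Some (r, q, a))] \<in> histories P g"

definition period_payoff :: "'f favor_params \<Rightarrow> 'n \<Rightarrow> 'n interaction \<Rightarrow> real" where
  "period_payoff P i m = (case m of
       None \<Rightarrow> 0
     | Some (r, q, Provide) \<Rightarrow> if i = r then benefit P else if i = q then - cost P else 0
     | Some (r, q, Refuse) \<Rightarrow> if i = q then - refusal_cost P else 0)"

text \<open>Expected discounted payoffs from the beginning of the period following \<open>h\<close>, valued at that period.\<close>

definition continuation_payoff ::
  "'f favor_params \<Rightarrow> 'n::finite set set \<Rightarrow> 'n profile \<Rightarrow> 'n \<Rightarrow> 'n history \<Rightarrow> real" where
  "continuation_payoff P g \<sigma> i h =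
     (\<Sum>n. discount P ^ n *
        measure_pmf.expectation (play P g \<sigma> h (Suc n)) (\<lambda>h'. period_payoff P i (snd (last h'))))"

text \<open>
  The same when, after \<open>h\<close> and the link decisions \<open>d\<close>, player \<open>i\<close> has been selected to do a favor
  to \<open>r\<close> and is about to act.
\<close>

definition action_payoff ::
  "'f favor_params \<Rightarrow> 'n::finite set set \<Rightarrow> 'n profile \<Rightarrow> 'n \<Rightarrow> 'n \<Rightarrow> 'n history \<Rightarrow> 'n decisions
     \<Rightarrow> real" where
  "action_payoff P g \<sigma> i r h d =
     measure_pmf.expectation (snd (\<sigma> i (private_history g i h) r))
       (\<lambda>a. period_payoff P i (Some (r, i, a))
            + discount P * continuation_payoff P g \<sigma> i (h @ [(d, Some (r, i, a))]))"

text \<open>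
  A player decides at two kinds of information sets: at the beginning of a period, where she knows
  her private history; and when selected to do a favor to \<open>r\<close>, where she also knows her own link
  decisions in that period.
\<close>

type_synonym 'n link_beliefs = "'n \<Rightarrow> 'n private_history \<Rightarrow> 'n history pmf"
type_synonym 'n action_beliefs =
  "'n \<Rightarrow> 'n private_history \<Rightarrow> ('n \<Rightarrow> link_choice) \<Rightarrow> 'n \<Rightarrow> ('n history \<times> 'n decisions) pmf"

definition bayes_link ::
  "'f favor_params \<Rightarrow> 'n::finite set set \<Rightarrow> 'n profile \<Rightarrow> 'n link_beliefs" where
  "bayes_link P g \<sigma> i I =
     cond_pmf (play P g \<sigma> [] (length (fst I))) {h. private_history g i h = I}"

definition bayes_action ::
  "'f favor_params \<Rightarrow> 'n::finite set set \<Rightarrow> 'n profile \<Rightarrow> 'n action_beliefs" where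
  "bayes_action P g \<sigma> i I e r =
     map_pmf (\<lambda>(h, d, m). (h, d))
       (cond_pmf
         (bind_pmf (play P g \<sigma> [] (length (fst I))) (\<lambda>h. map_pmf (Pair h) (pre_action P g \<sigma> h)))
         {(h, d, m). private_history g i h = I \<and> (\<lambda>j. d (i, j)) = e \<and> m = Some (r, i)})"

definition action_nodes ::
  "'f favor_params \<Rightarrow> 'n::finite set set \<Rightarrow> 'n \<Rightarrow> 'n \<Rightarrow> ('n history \<times> 'n decisions) set" where
  "action_nodes P g i r =
     {(h, d). h \<in> histories P g \<and> feasible_decisions g h d \<and>
              Some (r, i) \<in> set_pmf (matching P (prune (current_network g h) d))}"

definition totally_mixed :: "'f favor_params \<Rightarrow> 'n::finite set set \<Rightarrow> 'n profile \<Rightarrow> bool" where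
  "totally_mixed P g \<sigma> \<longleftrightarrow>
     (\<forall>i j. \<forall>h\<in>histories P g. i \<noteq> j \<longrightarrow>
        set_pmf (fst (\<sigma> i (private_history g i h) j)) = UNIV \<and>
        set_pmf (snd (\<sigma> i (private_history g i h) j)) = UNIV)"

definition pmf_converges :: "(nat \<Rightarrow> 'a pmf) \<Rightarrow> 'a pmf \<Rightarrow> bool" where
  "pmf_converges q q' \<longleftrightarrow> (\<forall>x. (\<lambda>k. pmf (q k) x) \<longlonglongrightarrow> pmf q' x)"

definition profile_converges ::
  "'f favor_params \<Rightarrow> 'n::finite set set \<Rightarrow> (nat \<Rightarrow> 'n profile) \<Rightarrow> 'n profile \<Rightarrow> bool" where
  "profile_converges P g s \<sigma> \<longleftrightarrow>
     (\<forall>i j. \<forall>h\<in>histories P g. i \<noteq> j \<longrightarrow>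
        pmf_converges (\<lambda>k. fst (s k i (private_history g i h) j))
          (fst (\<sigma> i (private_history g i h) j)) \<and>
        pmf_converges (\<lambda>k. snd (s k i (private_history g i h) j))
          (snd (\<sigma> i (private_history g i h) j)))"

definition consistent ::
  "'f favor_params \<Rightarrow> 'n::finite set set \<Rightarrow> 'n profile \<Rightarrow> 'n link_beliefs \<Rightarrow> 'n action_beliefs
     \<Rightarrow> bool" where
  "consistent P g \<sigma> \<mu> \<nu> \<longleftrightarrow>
     (\<exists>s. (\<forall>k. totally_mixed P g (s k)) \<and> profile_converges P g s \<sigma> \<and>
        (\<forall>i. \<forall>h\<in>histories P g.
           let I = private_history g i h
           in pmf_converges (\<lambda>k. bayes_link P g (s k) i I) (\<mu> i I)) \<and>
        (\<forall>i r. \<forall>(h, d)\<in>action_nodes P g i r.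
           let I = private_history g i h; e = (\<lambda>j. d (i, j))
           in pmf_converges (\<lambda>k. bayes_action P g (s k) i I e r) (\<nu> i I e r)))"

definition sequentially_rational ::
  "'f favor_params \<Rightarrow> 'n::finite set set \<Rightarrow> 'n profile \<Rightarrow> 'n link_beliefs \<Rightarrow> 'n action_beliefs
     \<Rightarrow> bool" where
  "sequentially_rational P g \<sigma> \<mu> \<nu> \<longleftrightarrow>
     (\<forall>i. \<forall>h\<in>histories P g. \<forall>\<tau>.
        let B = \<mu> i (private_history g i h)
        in measure_pmf.expectation B (continuation_payoff P g (\<sigma>(i := \<tau>)) i)
             \<le> measure_pmf.expectation B (continuation_payoff P g \<sigma> i)) \<and>
     (\<forall>i r. \<forall>(h, d)\<in>action_nodes P g i r. \<forall>\<tau>.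
        let B = \<nu> i (private_history g i h) (\<lambda>j. d (i, j)) r
        in measure_pmf.expectation B (\<lambda>(h', d'). action_payoff P g (\<sigma>(i := \<tau>)) i r h' d')
             \<le> measure_pmf.expectation B (\<lambda>(h', d'). action_payoff P g \<sigma> i r h' d'))"

definition sequential_equilibrium ::
  "'f favor_params \<Rightarrow> 'n::finite set set \<Rightarrow> 'n profile \<Rightarrow> 'n link_beliefs \<Rightarrow> 'n action_beliefs
     \<Rightarrow> bool" where
  "sequential_equilibrium P g \<sigma> \<mu> \<nu> \<longleftrightarrow>
     sequentially_rational P g \<sigma> \<mu> \<nu> \<and> consistent P g \<sigma> \<mu> \<nu>"

definition bilaterally_measurable :: "'f favor_params \<Rightarrow> 'n::finite set set \<Rightarrow> 'n profile \<Rightarrow> bool" where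
  "bilaterally_measurable P g \<sigma> \<longleftrightarrow>
     (\<forall>i j. \<forall>h\<in>histories P g. \<forall>h'\<in>histories P g. i \<noteq> j \<longrightarrow>
        bilateral_history j (private_history g i h) = bilateral_history j (private_history g i h') \<longrightarrow>
        \<sigma> i (private_history g i h) j = \<sigma> i (private_history g i h') j)"

definition bilateral_equilibrium :: "'f favor_params \<Rightarrow> 'n::finite set set \<Rightarrow> 'n profile \<Rightarrow> bool" where
  "bilateral_equilibrium P g \<sigma> \<longleftrightarrow>
     bilaterally_measurable P g \<sigma> \<and> (\<exists>\<mu> \<nu>. sequential_equilibrium P g \<sigma> \<mu> \<nu>)"

definition stable_bilateral_equilibrium ::
  "'f favor_params \<Rightarrow> 'n::finite set set \<Rightarrow> 'n profile \<Rightarrow> bool" where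
  "stable_bilateral_equilibrium P g \<sigma> \<longleftrightarrow>
     bilateral_equilibrium P g \<sigma> \<and>
     (\<forall>n. \<forall>h\<in>set_pmf (play P g \<sigma> [] n). \<forall>(d, m)\<in>set h.
        (\<forall>i j. {i, j} \<in> g \<longrightarrow> d (i, j) = Keep) \<and>
        (\<forall>r q a. m = Some (r, q, a) \<longrightarrow> a = Provide))"

definition stable_network :: "'f favor_params \<Rightarrow> 'n::finite set set \<Rightarrow> bool" where
  "stable_network P g \<longleftrightarrow> (\<exists>\<sigma>. stable_bilateral_equilibrium P g \<sigma>)"

text \<open>The payoff of \<open>i\<close> per period when all links of \<open>g\<close> are kept and all favors provided.\<close>

definition flow_payoff :: "'f favor_params \<Rightarrow> 'n set set \<Rightarrow> 'n \<Rightarrow> real" where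
  "flow_payoff P g i =
     req_prob P * benefit P * (1 - (1 - able_prob P) ^ deg g i)
     - (\<Sum>j\<in>neighbors g i.
          req_prob P * cost P * ((1 - (1 - able_prob P) ^ deg g j) / real (deg g j)))"

definition sustainable :: "'f favor_params \<Rightarrow> 'n set set \<Rightarrow> 'n set \<Rightarrow> bool" where
  "sustainable P g e \<longleftrightarrow>
     (\<forall>x\<in>e. discount P / (1 - discount P) * flow_payoff P g x
             - discount P / (1 - discount P) * flow_payoff P (g - {e}) x
             \<ge> cost P - refusal_cost P)"

end

theory Submission
  imports Defs "HOL-Complex_Analysis.Great_Picard" "HOL-Real_Asymp.Real_Asymp"
begin

text \<open>
  Necessity: along the equilibrium path every bilateral history without refusals occurs, so by
  measurability a player who refuses a favor to \<open>j\<close> and then cuts that link is treated as before by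
  everyone else and moves from the constant flow of \<open>g\<close> to that of \<open>g - ij\<close>. That this
  deviation does not pay is the sustainability of \<open>ij\<close>.

  Sufficiency: play bilateral trigger strategies. Explaining an observation of \<open>i\<close> never takes a
  mistake between two other players, since requests and abilities alone account for it; so
  in the limit of vanishing trembles \<open>i\<close> believes that all other links are intact. Her problem then
  depends only on her set \<open>T\<close> of unbroken links, with value \<open>W T\<close>. The marginal value of a link
  decreases in the size of \<open>T\<close>, so sustainability at \<open>g\<close> gives
  \<open>c - \<gamma> \<le> \<delta> (W T - W (T - {j}))\<close> for all \<open>T\<close>, and \<open>W\<close> solves the Bellman equation.
\<close>

section \<open>Finitely supported distributions\<close>

text \<open>The deviation behind necessity is a plan fixed at the empty history, where the belief is
  a point mass; at the information set where the favor is refused one would have to average over the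
  histories leading there. Cutting the link afterwards is essential too: measurability and stability
  say nothing about how the partner acts after a refusal, and without the link this no longer
  matters. Waiting for the request multiplies gain and loss by the same positive probability, which
  cancels.

  For sufficiency, \<open>W T\<close> has a closed form because the cost share of a link with
  \<open>j\<close> depends only on the degree of \<open>j\<close>. While the links among others are
  intact, a surviving neighbor of \<open>i\<close> keeps its degree in \<open>g\<close> whatever
  else \<open>i\<close> has lost, so costs are additive over links and only the benefit is concave.
  Beliefs are controlled without being computed: a history is compared with one counterpart in the
  same information set, and the likelihood ratio is at most a constant not depending on the tremble,
  times the tremble if others have erred among themselves.\<close>

lemma set_pmf_exists: "\<exists>x. x \<in> set_pmf M"
  using set_pmf_not_empty[of M] by blast

lemma expectation_bind_finite:
  fixes h :: "'b \<Rightarrow> real"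
  assumes "finite (set_pmf p)" "\<And>x. x \<in> set_pmf p \<Longrightarrow> finite (set_pmf (f x))"
  shows "measure_pmf.expectation (bind_pmf p f) h =
    measure_pmf.expectation p (\<lambda>x. measure_pmf.expectation (f x) h)"
proof -
  have "measure_pmf.expectation (bind_pmf p f) h =
      (\<Sum>a\<in>set_pmf p. pmf p a *\<^sub>R measure_pmf.expectation (f a) h)"
    by (rule pmf_expectation_bind) (use assms in auto)
  also have "\<dots> = measure_pmf.expectation p (\<lambda>x. measure_pmf.expectation (f x) h)"
    by (rule integral_measure_pmf[symmetric]) (use assms in auto)
  finally show ?thesis .
qed

lemma expectation_cong_pmf:
  fixes f f' :: "'a \<Rightarrow> real"
  assumes "\<And>x. x \<in> set_pmf p \<Longrightarrow> f x = f' x"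
  shows "measure_pmf.expectation p f = measure_pmf.expectation p f'"
  by (rule integral_cong_AE) (use assms in \<open>auto simp: AE_measure_pmf_iff\<close>)

lemma expectation_mono_finite:
  fixes f f' :: "'a \<Rightarrow> real"
  assumes "finite (set_pmf p)" "\<And>x. x \<in> set_pmf p \<Longrightarrow> f x \<le> f' x"
  shows "measure_pmf.expectation p f \<le> measure_pmf.expectation p f'"
  by (rule integral_mono_AE)
     (use assms in \<open>auto simp: AE_measure_pmf_iff integrable_measure_pmf_finite\<close>)

lemma expectation_le_const:
  fixes f :: "'a \<Rightarrow> real"
  assumes "finite (set_pmf p)" "\<And>x. x \<in> set_pmf p \<Longrightarrow> f x \<le> K"
  shows "measure_pmf.expectation p f \<le> K"
  using expectation_mono_finite[of p f "\<lambda>_. K"] assms by simp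

lemma expectation_eq_const:
  fixes f :: "'a \<Rightarrow> real"
  assumes "\<And>x. x \<in> set_pmf p \<Longrightarrow> f x = K"
  shows "measure_pmf.expectation p f = K"
  using expectation_cong_pmf[of p f "\<lambda>_. K"] assms by simp

lemma prob_no_success:
  assumes "finite A" "N \<subseteq> A" "0 \<le> q" "q \<le> 1"
  shows "measure_pmf.prob (Pi_pmf A False (\<lambda>_. bernoulli_pmf q)) {f. \<forall>x\<in>N. \<not> f x} = (1 - q) ^ card N"
proof -
  \<comment> \<open>The event and the product set differ only in functions that are not
    \<open>False\<close> outside \<open>A\<close>; these carry no mass.\<close>
  have "measure_pmf.prob (Pi_pmf A False (\<lambda>_. bernoulli_pmf q)) {f. \<forall>x\<in>N. \<not> f x}
     = measure_pmf.prob (Pi_pmf A False (\<lambda>_. bernoulli_pmf q))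
         (PiE_dflt A False (\<lambda>x. if x \<in> N then {False} else UNIV))"
    by (rule measure_prob_cong_0)
       (use assms in \<open>auto simp: PiE_dflt_def pmf_Pi split: if_splits\<close>)
  also have "\<dots> = (\<Prod>x\<in>A. measure_pmf.prob (bernoulli_pmf q) (if x \<in> N then {False} else UNIV))"
    by (rule measure_Pi_pmf_PiE_dflt) fact
  also have "\<dots> = (\<Prod>x\<in>A. if x \<in> N then 1 - q else 1)"
    by (rule prod.cong) (use assms in \<open>auto simp: measure_pmf_single\<close>)
  also have "\<dots> = (1 - q) ^ card N"
    using assms by (simp add: prod.If_cases Int_absorb1)
  finally show ?thesis .
qed

text \<open>The intended choice is \<open>x\<close>, the error \<open>y\<close>. Allowing
  \<open>\<epsilon> = 0\<close> puts the equilibrium and its perturbations into one family.\<close>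

definition tremble :: "real \<Rightarrow> 'a \<Rightarrow> 'a \<Rightarrow> 'a pmf" where
  "tremble \<epsilon> x y = map_pmf (\<lambda>t. if t then y else x) (bernoulli_pmf \<epsilon>)"

lemma tremble_0 [simp]: "tremble 0 x y = return_pmf x"
proof -
  have "bernoulli_pmf 0 = return_pmf False"
    unfolding set_pmf_subset_singleton[symmetric] by (auto simp: set_pmf_iff)
  then show ?thesis by (simp add: tremble_def)
qed

lemma pmf_tremble:
  assumes "x \<noteq> y" "0 \<le> \<epsilon>" "\<epsilon> \<le> 1"
  shows "pmf (tremble \<epsilon> x y) x = 1 - \<epsilon>" "pmf (tremble \<epsilon> x y) y = \<epsilon>"
proof -
  have "pmf (tremble \<epsilon> x y) x = measure_pmf.prob (bernoulli_pmf \<epsilon>) {False}"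
    using assms(1) unfolding tremble_def pmf_map
    by (intro arg_cong[where f = "measure_pmf.prob _"]) (auto split: if_splits)
  then show "pmf (tremble \<epsilon> x y) x = 1 - \<epsilon>" using assms by (simp add: measure_pmf_single)
  have "pmf (tremble \<epsilon> x y) y = measure_pmf.prob (bernoulli_pmf \<epsilon>) {True}"
    using assms(1) unfolding tremble_def pmf_map
    by (intro arg_cong[where f = "measure_pmf.prob _"]) (auto split: if_splits)
  then show "pmf (tremble \<epsilon> x y) y = \<epsilon>" using assms by (simp add: measure_pmf_single)
qed

text \<open>A history records all earlier periods, so it can arise from one intermediate state only;
  this turns likelihoods of histories into plain products.\<close>

lemma pmf_bind_unique:
  assumes "\<And>y. y \<in> set_pmf M \<Longrightarrow> y \<noteq> y0 \<Longrightarrow> pmf (f y) x = 0"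
  shows "pmf (bind_pmf M f) x = pmf M y0 * pmf (f y0) x"
proof -
  have "pmf (bind_pmf M f) x = measure_pmf.expectation M (\<lambda>y. pmf (f y) x)"
    by (rule pmf_bind)
  also have "\<dots> = measure_pmf.expectation M (\<lambda>y. pmf (f y0) x * indicator {y0} y)"
    by (rule expectation_cong_pmf) (use assms in \<open>auto simp: indicator_def\<close>)
  also have "\<dots> = pmf M y0 * pmf (f y0) x"
    by (simp add: measure_pmf_single)
  finally show ?thesis .
qed

text \<open>Conditioning rescales all of \<open>E\<close> by the same factor, so a likelihood ratio
  against any single competitor \<open>x'\<close> in \<open>E\<close> already bounds the posterior
  of \<open>x\<close>. No normalizing constant has to be estimated.\<close>

lemma pmf_cond_le:
  assumes "set_pmf M \<inter> E \<noteq> {}" "x' \<in> E" "pmf M x \<le> \<eta> * pmf M x'" "0 \<le> \<eta>"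
  shows "pmf (cond_pmf M E) x \<le> \<eta>"
proof (cases "x \<in> E")
  case True
  have pos: "0 < measure_pmf.prob M E"
    using assms(1) by (auto intro: measure_pmf_posI)
  have "pmf (cond_pmf M E) x = pmf M x / measure_pmf.prob M E"
    using True by (simp add: pmf_cond[OF assms(1)])
  also have "\<dots> \<le> \<eta> * pmf M x' / measure_pmf.prob M E"
    using pos assms(3) by (intro divide_right_mono) auto
  also have "\<dots> = \<eta> * pmf (cond_pmf M E) x'"
    using assms(2) by (simp add: pmf_cond[OF assms(1)])
  also have "\<dots> \<le> \<eta> * 1"
    by (intro mult_left_mono assms(4) pmf_le_1)
  finally show ?thesis by simp
qed (use assms(4) in \<open>simp add: pmf_cond[OF assms(1)]\<close>)

text \<open>A common finite support keeps mass from escaping, so the pointwise limits still sum to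
  one.\<close>

lemma pmf_converges_exists:
  assumes "finite A" "\<And>k. set_pmf (X k) \<subseteq> A" "\<And>x. convergent (\<lambda>k. pmf (X k) x)"
  shows "\<exists>X'. pmf_converges X X'"
proof -
  define w where "w x = lim (\<lambda>k. pmf (X k) x)" for x
  have w: "(\<lambda>k. pmf (X k) x) \<longlonglongrightarrow> w x" for x
    using assms(3) by (simp add: w_def convergent_LIMSEQ_iff)
  have nonneg: "0 \<le> w x" for x by (rule LIMSEQ_le_const[OF w]) auto
  have outside: "w x = 0" if "x \<notin> A" for x
  proof -
    have "pmf (X k) x = 0" for k using that assms(2) by (auto simp: pmf_eq_0_set_pmf)
    then show ?thesis using w[of x] by (simp add: LIMSEQ_const_iff)
  qed
  have "(\<lambda>k. \<Sum>x\<in>A. pmf (X k) x) \<longlonglongrightarrow> (\<Sum>x\<in>A. w x)" by (intro tendsto_sum w)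
  moreover have "(\<Sum>x\<in>A. pmf (X k) x) = 1" for k by (rule sum_pmf_eq_1) (use assms in auto)
  ultimately have sum: "(\<Sum>x\<in>A. w x) = 1" by (simp add: LIMSEQ_const_iff)
  have "(\<integral>\<^sup>+x. ennreal (w x) \<partial>count_space UNIV) = (\<integral>\<^sup>+x. ennreal (w x) \<partial>count_space A)"
    by (rule nn_integral_count_space_eq) (use outside in auto)
  also have "\<dots> = (\<Sum>x\<in>A. ennreal (w x))"
    using assms(1) by (simp add: nn_integral_count_space_finite)
  also have "\<dots> = 1" using sum nonneg by (simp add: sum_ennreal)
  finally have "pmf (embed_pmf w) x = w x" for x
    using nonneg by (intro pmf_embed_pmf) auto
  then have "pmf_converges X (embed_pmf w)" using w by (simp add: pmf_converges_def)
  then show ?thesis by blast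
qed

lemma pmf_converges_support:
  assumes "pmf_converges X X'" "\<And>k. pmf (X k) x \<le> b k" "b \<longlonglongrightarrow> 0"
  shows "x \<notin> set_pmf X'"
proof -
  have "pmf X' x \<le> 0"
    by (rule LIMSEQ_le[of "\<lambda>k. pmf (X k) x" _ b])
       (use assms in \<open>auto simp: pmf_converges_def\<close>)
  then show ?thesis by (simp add: set_pmf_iff)
qed

lemma set_pmf_tremble:
  assumes "0 < \<epsilon>" "\<epsilon> < 1"
  shows "set_pmf (tremble \<epsilon> x y) = {x, y}"
  using assms by (auto simp: tremble_def set_pmf_bernoulli UNIV_bool)

lemma tremble_converges:
  assumes "x \<noteq> y" "UNIV = {x, y}" "\<And>k. 0 \<le> e k" "\<And>k. e k \<le> 1" "e \<longlonglongrightarrow> 0"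
  shows "pmf_converges (\<lambda>k. tremble (e k) x y) (tremble 0 x y)"
  unfolding pmf_converges_def
proof
  fix z
  have "(\<lambda>k. 1 - e k) \<longlonglongrightarrow> 1 - 0" by (intro tendsto_intros assms)
  moreover have "z = x \<or> z = y" using assms(2) by auto
  ultimately show "(\<lambda>k. pmf (tremble (e k) x y) z) \<longlonglongrightarrow> pmf (tremble 0 x y) z"
    using assms by (auto simp: pmf_tremble simp del: tremble_0)
qed

lemma pmf_map_unique:
  assumes "f z0 = y" "\<And>z. z \<in> set_pmf M \<Longrightarrow> f z = y \<Longrightarrow> z = z0"
  shows "pmf (map_pmf f M) y = pmf M z0"
proof -
  have "pmf (map_pmf f M) y = pmf M z0 * pmf (return_pmf (f z0)) y"
    unfolding map_pmf_def by (rule pmf_bind_unique) (use assms(2) in \<open>auto simp: indicator_def\<close>)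
  then show ?thesis by (simp add: assms(1))
qed

section \<open>Matching\<close>

locale favor_exchange =
  fixes P :: "'f favor_params" and g :: "'n::finite set set"
  assumes params: "valid_params TYPE('n) P"
    and network_g: "network g"
begin

abbreviation "\<alpha> \<equiv> req_prob P"
abbreviation "p \<equiv> able_prob P"
abbreviation "\<delta> \<equiv> discount P"
abbreviation "v \<equiv> benefit P"
abbreviation "c \<equiv> cost P"
abbreviation "\<gamma> \<equiv> refusal_cost P"
abbreviation "prob_able G i \<equiv> 1 - (1 - p) ^ deg G i"

lemma params_simps:
  "0 < \<alpha>" "real CARD('n) * \<alpha> \<le> 1" "0 \<le> real CARD('n) * \<alpha>" "0 < p" "p < 1" "0 < \<delta>" "\<delta> < 1"
  "0 < c" "c < v" "0 \<le> \<gamma>" "\<gamma> < c" "finite (favor_types P)" "favor_types P \<noteq> {}"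
  using params by (auto simp: valid_params_def)

lemma network_subset: "network G \<Longrightarrow> G' \<subseteq> G \<Longrightarrow> network G'"
  by (auto simp: network_def)

lemma network_irrefl: "network G \<Longrightarrow> {a, b} \<in> G \<Longrightarrow> a \<noteq> b"
  by (auto simp: network_def)

lemma neighbors_irrefl: "network G \<Longrightarrow> a \<notin> neighbors G a"
  by (auto simp: neighbors_def network_def)

lemma neighbors_sym: "a \<in> neighbors G b \<longleftrightarrow> b \<in> neighbors G a"
  by (simp add: neighbors_def insert_commute)

section \<open>Able players and the support of the matching\<close>

definition able :: "'n \<Rightarrow> 'n set pmf" where
  "able r = map_pmf Collect (Pi_pmf (UNIV - {r}) False (\<lambda>_. bernoulli_pmf p))"

lemma able_players_eq: "able_players P r f = able r"
  by (simp add: able_players_def able_def)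

lemma set_pmf_able: "set_pmf (able r) = Pow (UNIV - {r})"
proof -
  have "set_pmf (bernoulli_pmf p) = UNIV"
    using params_simps by (simp add: set_pmf_bernoulli)
  then have "set_pmf (able r) = Collect ` {f. \<not> f r}"
    by (simp add: able_def set_Pi_pmf PiE_dflt_def)
  also have "\<dots> = Pow (UNIV - {r})"
  proof (intro equalityI subsetI)
    fix A assume "A \<in> Pow (UNIV - {r})"
    then show "A \<in> Collect ` {f. \<not> f r}"
      by (intro image_eqI[of _ _ "\<lambda>x. x \<in> A"]) auto
  qed auto
  finally show ?thesis .
qed

definition select :: "'n set set \<Rightarrow> 'n \<Rightarrow> ('n \<times> 'n) option pmf" where
  "select G r = bind_pmf (able r) (\<lambda>A.
     if A \<inter> neighbors G r = {} then return_pmf None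
     else map_pmf (\<lambda>j. Some (r, j)) (pmf_of_set (A \<inter> neighbors G r)))"

text \<open>Favors being substitutable, the favor type influences nothing after it is drawn and
  integrates out.\<close>

lemma matching_eq:
  fixes G :: "'n set set"
  shows "matching P G = bind_pmf (bernoulli_pmf (real CARD('n) * \<alpha>))
     (\<lambda>b. if b then bind_pmf (pmf_of_set UNIV) (select G) else return_pmf None)"
  unfolding matching_def request_def bind_assoc_pmf select_def able_players_eq
  by (intro bind_pmf_cong refl)
     (auto simp: bind_return_pmf bind_map_pmf pair_pmf_def bind_assoc_pmf)

lemma set_pmf_select:
  assumes "network G"
  shows "set_pmf (select G r) = insert None {Some (r, q) |q. q \<in> neighbors G r}"
proof -
  have "set_pmf (select G r) = (\<Union>A\<in>Pow (UNIV - {r}).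
      if A \<inter> neighbors G r = {} then {None} else (\<lambda>j. Some (r, j)) ` (A \<inter> neighbors G r))"
    unfolding select_def set_bind_pmf set_pmf_able
    by (intro SUP_cong refl) (auto simp: set_pmf_of_set)
  also have "\<dots> = insert None {Some (r, q) |q. q \<in> neighbors G r}" (is "?L = ?R")
  proof (intro equalityI subsetI)
    fix x assume "x \<in> ?R"
    then consider "x = None" | q where "x = Some (r, q)" "q \<in> neighbors G r" by auto
    then show "x \<in> ?L"
    proof cases
      case 1
      then show ?thesis by (intro UN_I[of "{}"]) auto
    next
      case 2
      then show ?thesis using neighbors_irrefl[OF assms] by (intro UN_I[of "{q}"]) auto
    qed
  qed (auto split: if_splits)
  finally show ?thesis .
qed

text \<open>As \<open>0 < p < 1\<close>, each set of other players can be the able one; as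
  \<open>\<alpha> > 0\<close>, each player can be the requester. The presence of \<open>None\<close>
  matters most: an idle period is always possible, so erasing an interaction from a history never
  makes it impossible.\<close>

lemma set_pmf_matching:
  fixes G :: "'n set set"
  assumes "network G"
  shows "set_pmf (matching P G) = insert None {Some (r, q) |r q. {r, q} \<in> G}"
proof -
  have "True \<in> set_pmf (bernoulli_pmf (real CARD('n) * \<alpha>))"
    using params_simps by (simp add: set_pmf_iff)
  then show ?thesis
    unfolding matching_eq
    by (auto simp: set_pmf_select[OF assms] set_pmf_of_set neighbors_def
      insert_commute split: if_splits; metis)
qed

text \<open>The probability that \<open>j\<close> is the selected provider, given that
  \<open>r\<close> requires a favor.\<close>

definition sel :: "'n set set \<Rightarrow> 'n \<Rightarrow> 'n \<Rightarrow> real" where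
  "sel G r j = measure_pmf.expectation (able r)
     (\<lambda>A. if j \<in> A \<inter> neighbors G r then 1 / real (card (A \<inter> neighbors G r)) else 0)"

lemma expectation_select:
  assumes "\<psi> None = (0 :: real)"
  shows "measure_pmf.expectation (select G r) \<psi> = (\<Sum>j\<in>neighbors G r. sel G r j * \<psi> (Some (r, j)))"
proof -
  have "measure_pmf.expectation (select G r) \<psi> = measure_pmf.expectation (able r)
     (\<lambda>A. \<Sum>j\<in>neighbors G r.
        (if j \<in> A \<inter> neighbors G r then 1 / real (card (A \<inter> neighbors G r)) else 0) * \<psi> (Some (r, j)))"
    unfolding select_def
  proof (subst expectation_bind_finite)
    fix A :: "'n set"
    let ?N = "A \<inter> neighbors G r"
    show "finite (set_pmf (if ?N = {} then return_pmf None else map_pmf (\<lambda>j. Some (r, j)) (pmf_of_set ?N)))"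
      by simp
  next
    show "measure_pmf.expectation (able r) (\<lambda>A. measure_pmf.expectation
        (if A \<inter> neighbors G r = {} then return_pmf None
         else map_pmf (\<lambda>j. Some (r, j)) (pmf_of_set (A \<inter> neighbors G r))) \<psi>) =
      measure_pmf.expectation (able r) (\<lambda>A. \<Sum>j\<in>neighbors G r.
        (if j \<in> A \<inter> neighbors G r then 1 / real (card (A \<inter> neighbors G r)) else 0) * \<psi> (Some (r, j)))"
    proof (rule expectation_cong_pmf)
      fix A :: "'n set"
      let ?N = "A \<inter> neighbors G r"
      have "(\<Sum>j\<in>neighbors G r. (if j \<in> ?N then 1 / real (card ?N) else 0) * \<psi> (Some (r, j)))
          = (\<Sum>j\<in>?N. 1 / real (card ?N) * \<psi> (Some (r, j)))"
        by (rule sum.mono_neutral_cong_right) auto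
      then show "measure_pmf.expectation
          (if ?N = {} then return_pmf None else map_pmf (\<lambda>j. Some (r, j)) (pmf_of_set ?N)) \<psi> =
        (\<Sum>j\<in>neighbors G r. (if j \<in> ?N then 1 / real (card ?N) else 0) * \<psi> (Some (r, j)))"
        by (simp add: assms integral_pmf_of_set sum_divide_distrib)
    qed
  qed simp_all
  also have "\<dots> = (\<Sum>j\<in>neighbors G r. sel G r j * \<psi> (Some (r, j)))"
    unfolding sel_def by (simp add: integrable_measure_pmf_finite)
  finally show ?thesis .
qed

text \<open>The probability \<open>CARD('n) * \<alpha>\<close> of some request and the uniform draw
  of the requester combine to \<open>\<alpha>\<close> per player.\<close>

lemma expectation_matching:
  fixes G :: "'n set set"
  assumes "\<psi> None = (0 :: real)"
  shows "measure_pmf.expectation (matching P G) \<psi> =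
    (\<Sum>r\<in>UNIV. \<alpha> * (\<Sum>j\<in>neighbors G r. sel G r j * \<psi> (Some (r, j))))"
proof -
  have "measure_pmf.expectation (matching P G) \<psi> =
      real CARD('n) * \<alpha> * measure_pmf.expectation (bind_pmf (pmf_of_set UNIV) (select G)) \<psi>"
    unfolding matching_eq using params_simps assms
    by (subst expectation_bind_finite) (auto simp: integral_bernoulli_pmf)
  also have "\<dots> = real CARD('n) * \<alpha> * ((\<Sum>r\<in>UNIV. (\<Sum>j\<in>neighbors G r. sel G r j * \<psi> (Some (r, j)))) / real CARD('n))"
    by (subst expectation_bind_finite) (auto simp: integral_pmf_of_set expectation_select[of \<psi>, OF assms])
  also have "\<dots> = \<alpha> * (\<Sum>r\<in>UNIV. (\<Sum>j\<in>neighbors G r. sel G r j * \<psi> (Some (r, j))))"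
    by simp
  also have "\<dots> = (\<Sum>r\<in>UNIV. \<alpha> * (\<Sum>j\<in>neighbors G r. sel G r j * \<psi> (Some (r, j))))"
    by (rule sum_distrib_left)
  finally show ?thesis .
qed

text \<open>For a fixed able set the selection shares add up to 1, unless no neighbor is able; the
  sum is thus the probability that some neighbor is able.\<close>

lemma sum_sel:
  assumes "network G"
  shows "(\<Sum>j\<in>neighbors G r. sel G r j) = prob_able G r"
proof -
  have "(\<Sum>j\<in>neighbors G r. sel G r j) =
      measure_pmf.expectation (able r) (\<lambda>A. if A \<inter> neighbors G r = {} then 0 else 1)"
  proof -
    have "(\<Sum>j\<in>neighbors G r. sel G r j) = measure_pmf.expectation (able r) (\<lambda>A.
        \<Sum>j\<in>neighbors G r. if j \<in> A \<inter> neighbors G r then 1 / real (card (A \<inter> neighbors G r)) else 0)"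
      unfolding sel_def by (simp add: integrable_measure_pmf_finite)
    also have "\<dots> = measure_pmf.expectation (able r) (\<lambda>A. if A \<inter> neighbors G r = {} then 0 else 1)"
    proof (rule expectation_cong_pmf)
      fix A :: "'n set"
      let ?N = "A \<inter> neighbors G r"
      have "(\<Sum>j\<in>neighbors G r. if j \<in> ?N then 1 / real (card ?N) else 0) = (\<Sum>j\<in>?N. 1 / real (card ?N))"
        by (rule sum.mono_neutral_cong_right) auto
      then show "(\<Sum>j\<in>neighbors G r. if j \<in> ?N then 1 / real (card ?N) else 0) = (if ?N = {} then 0 else 1)"
        by auto
    qed
    finally show ?thesis .
  qed
  also have "\<dots> = measure_pmf.expectation (able r) (\<lambda>A. 1 - indicator {A. A \<inter> neighbors G r = {}} A)"
    by (rule expectation_cong_pmf) auto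
  also have "\<dots> = 1 - measure_pmf.prob (able r) {A. A \<inter> neighbors G r = {}}"
    by (subst Bochner_Integration.integral_diff) (simp_all add: integrable_measure_pmf_finite)
  also have "measure_pmf.prob (able r) {A. A \<inter> neighbors G r = {}} =
      measure_pmf.prob (Pi_pmf (UNIV - {r}) False (\<lambda>_. bernoulli_pmf p)) {f. \<forall>x\<in>neighbors G r. \<not> f x}"
    unfolding able_def measure_map_pmf by (rule arg_cong[where f = "measure_pmf.prob _"]) auto
  also have "\<dots> = (1 - p) ^ deg G r"
    unfolding deg_def by (rule prob_no_success)
      (use params_simps neighbors_irrefl[OF assms] in auto)
  finally show ?thesis .
qed

text \<open>Symmetry between providers: transposing \<open>j\<close> and \<open>k\<close> fixes
  \<open>r\<close>, the neighborhood of \<open>r\<close> and the product law of abilities, and it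
  carries the event of selecting \<open>j\<close> to that of selecting \<open>k\<close>.\<close>

lemma sel_exchange:
  assumes "network G" "j \<in> neighbors G r" "k \<in> neighbors G r"
  shows "sel G r j = sel G r k"
proof -
  let ?t = "Transposition.transpose j k"
  have r: "j \<noteq> r" "k \<noteq> r" using assms neighbors_irrefl[OF assms(1)] by auto
  have inv: "?t -` neighbors G r = neighbors G r"
    using assms(2,3) by (auto simp: Transposition.transpose_def split: if_splits)
  have "Pi_pmf (UNIV - {r}) False (\<lambda>_. bernoulli_pmf p) =
      map_pmf (\<lambda>f. f \<circ> ?t) (Pi_pmf (UNIV - {r}) False (\<lambda>_. bernoulli_pmf p))"
  proof (rule Pi_pmf_bij_betw)
    show "bij_betw ?t (UNIV - {r}) (UNIV - {r})"
      by (rule bij_betw_byWitness[where f' = ?t])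
         (use r in \<open>auto simp: Transposition.transpose_def\<close>)
  qed (use r in \<open>auto simp: Transposition.transpose_def\<close>)
  then have "able r = map_pmf Collect (map_pmf (\<lambda>f. f \<circ> ?t) (Pi_pmf (UNIV - {r}) False (\<lambda>_. bernoulli_pmf p)))"
    unfolding able_def by (rule arg_cong)
  also have "\<dots> = map_pmf (\<lambda>A. ?t -` A) (able r)"
    unfolding able_def map_pmf_comp by (rule map_pmf_cong) auto
  finally have "able r = map_pmf (\<lambda>A. ?t -` A) (able r)" .
  then have "sel G r j = measure_pmf.expectation (map_pmf (\<lambda>A. ?t -` A) (able r))
     (\<lambda>A. if j \<in> A \<inter> neighbors G r then 1 / real (card (A \<inter> neighbors G r)) else 0)"
    unfolding sel_def by simp
  also have "\<dots> = sel G r k"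
    unfolding sel_def integral_map_pmf
  proof (rule expectation_cong_pmf)
    fix A :: "'n set"
    have "?t -` A \<inter> neighbors G r = ?t -` (A \<inter> neighbors G r)" using inv by auto
    moreover have "card (?t -` (A \<inter> neighbors G r)) = card (A \<inter> neighbors G r)"
      by (rule card_vimage_inj) simp_all
    ultimately have "card (?t -` A \<inter> neighbors G r) = card (A \<inter> neighbors G r)" by simp
    moreover have "j \<in> ?t -` A \<inter> neighbors G r \<longleftrightarrow> k \<in> A \<inter> neighbors G r" using assms by auto
    ultimately show "(if j \<in> ?t -` A \<inter> neighbors G r then 1 / real (card (?t -` A \<inter> neighbors G r)) else 0)
      = (if k \<in> A \<inter> neighbors G r then 1 / real (card (A \<inter> neighbors G r)) else 0)" by presburger
  qed
  finally show ?thesis .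
qed

lemma sel_eq:
  assumes "network G" "j \<in> neighbors G r"
  shows "sel G r j = prob_able G r / real (deg G r)"
proof -
  have "prob_able G r = (\<Sum>k\<in>neighbors G r. sel G r j)"
    unfolding sum_sel[OF assms(1), symmetric]
    by (intro sum.cong refl sel_exchange assms)
  moreover have "deg G r \<noteq> 0" using assms(2) by (auto simp: deg_def)
  ultimately show ?thesis by (simp add: deg_def)
qed

definition full_payoff :: "'n \<Rightarrow> ('n \<times> 'n) option \<Rightarrow> real" where
  "full_payoff i m = period_payoff P i (map_option (\<lambda>(r, q). (r, q, Provide)) m)"

text \<open>The origin of the flow formula: as requester, \<open>i\<close> receives \<open>v\<close>
  whenever some neighbor is able; as provider to \<open>r\<close> she bears, by
  \<open>sel_eq\<close>, an equal share of the favors that \<open>r\<close> obtains.\<close>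

lemma expectation_full_payoff:
  fixes G :: "'n set set"
  assumes "network G"
  shows "measure_pmf.expectation (matching P G) (full_payoff i) = flow_payoff P G i"
proof -
  have "measure_pmf.expectation (matching P G) (full_payoff i) =
      (\<Sum>r\<in>UNIV. \<alpha> * (\<Sum>j\<in>neighbors G r. sel G r j * full_payoff i (Some (r, j))))"
    by (rule expectation_matching) (simp add: full_payoff_def period_payoff_def)
  also have "\<dots> = \<alpha> * (\<Sum>j\<in>neighbors G i. sel G i j * full_payoff i (Some (i, j)))
      + (\<Sum>r\<in>UNIV - {i}. \<alpha> * (\<Sum>j\<in>neighbors G r. sel G r j * full_payoff i (Some (r, j))))"
    by (simp add: sum.remove)
  also have "(\<Sum>j\<in>neighbors G i. sel G i j * full_payoff i (Some (i, j))) = prob_able G i * v"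
    unfolding sum_sel[OF assms, symmetric] by (simp add: full_payoff_def period_payoff_def sum_distrib_right)
  also have "(\<Sum>r\<in>UNIV - {i}. \<alpha> * (\<Sum>j\<in>neighbors G r. sel G r j * full_payoff i (Some (r, j))))
      = (\<Sum>r\<in>neighbors G i. - (\<alpha> * c * (prob_able G r / real (deg G r))))"
  proof (rule sum.mono_neutral_cong_right)
    show "neighbors G i \<subseteq> UNIV - {i}" using neighbors_irrefl[OF assms] by auto
    have *: "(\<Sum>j\<in>neighbors G r. sel G r j * full_payoff i (Some (r, j))) =
        (\<Sum>j\<in>neighbors G r. if j = i then - (c * sel G r j) else 0)" if "r \<noteq> i" for r
      using that by (intro sum.cong) (auto simp: full_payoff_def period_payoff_def)
    show "\<forall>r\<in>UNIV - {i} - neighbors G i.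
        \<alpha> * (\<Sum>j\<in>neighbors G r. sel G r j * full_payoff i (Some (r, j))) = 0"
      using * by (auto simp: sum.delta neighbors_sym)
    show "\<alpha> * (\<Sum>j\<in>neighbors G r. sel G r j * full_payoff i (Some (r, j))) =
        - (\<alpha> * c * (prob_able G r / real (deg G r)))" if "r \<in> neighbors G i" for r
    proof -
      have "i \<in> neighbors G r" "r \<noteq> i" using that neighbors_irrefl[OF assms] by (auto simp: neighbors_sym)
      then show ?thesis using *[of r] by (simp add: sel_eq[OF assms])
    qed
  qed simp
  finally show ?thesis by (simp add: flow_payoff_def sum_negf algebra_simps)
qed

lemma expectation_full_payoff_add:
  fixes G :: "'n set set"
  assumes "network G"
  shows "measure_pmf.expectation (matching P G) (\<lambda>m. full_payoff i m + K) = flow_payoff P G i + K"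
  by (subst Bochner_Integration.integral_add)
     (simp_all add: integrable_measure_pmf_finite expectation_full_payoff[OF assms])

end

section \<open>Histories and discounted payoffs\<close>

lemma UNIV_link_choice: "UNIV = {Keep, Remove}"
  using link_choice.exhaust by auto

lemma UNIV_action: "UNIV = {Provide, Refuse}"
  using action.exhaust by auto

instance link_choice :: finite
  by standard (simp add: UNIV_link_choice)

instance action :: finite
  by standard (simp add: UNIV_action)

context favor_exchange
begin

text \<open>The state of a pair under trigger strategies. A refusal in either direction breaks it,
  while a removal of the link does not count, since bilateral histories record interactions
  only.\<close>

definition clean :: "'n history \<Rightarrow> 'n \<Rightarrow> 'n \<Rightarrow> bool" where
  "clean h a b \<longleftrightarrow> (\<forall>r q d. (d, Some (r, q, Refuse)) \<in> set h \<longrightarrow> {r, q} \<noteq> {a, b})"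

lemma clean_sym: "clean h a b \<longleftrightarrow> clean h b a"
  by (simp add: clean_def insert_commute)

lemma clean_Nil [simp]: "clean [] a b"
  by (simp add: clean_def)

lemma clean_snoc:
  "clean (h @ [(d, m)]) a b \<longleftrightarrow> clean h a b \<and> (\<forall>r q. m = Some (r, q, Refuse) \<longrightarrow> {r, q} \<noteq> {a, b})"
  by (auto simp: clean_def)

lemma clean_snoc_simps [simp]:
  "clean (h @ [(d, None)]) a b \<longleftrightarrow> clean h a b"
  "clean (h @ [(d, Some (r, q, Provide))]) a b \<longleftrightarrow> clean h a b"
  "clean (h @ [(d, Some (r, q, Refuse))]) a b \<longleftrightarrow> clean h a b \<and> {r, q} \<noteq> {a, b}"
  by (auto simp: clean_snoc)

lemma bilateral_history_eq:
  "bilateral_history b (private_history g a h) = map (\<lambda>x. involving b (involving a (snd x))) h"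
  by (rule nth_equalityI) (auto simp: bilateral_history_def private_history_def)

lemma length_private_history [simp]: "length (fst (private_history g a h)) = length h"
  by (simp add: private_history_def)

lemma involving_involving:
  assumes "a \<noteq> b"
  shows "involving b (involving a m) = Some (r, q, x) \<longleftrightarrow> m = Some (r, q, x) \<and> {r, q} = {a, b}"
  using assms by (cases m) (auto simp: involving_def doubleton_eq_iff split: if_splits)

text \<open>Both partners see every interaction between them, so the state of the pair is a function
  of the bilateral history and admissible as a condition in a measurable strategy.\<close>

lemma clean_bilateral:
  assumes "a \<noteq> b"
  shows "clean h a b \<longleftrightarrow>
    (\<forall>r q. Some (r, q, Refuse) \<notin> set (bilateral_history b (private_history g a h)))"
proof -
  have "Some (r, q, Refuse) \<in> set (bilateral_history b (private_history g a h)) \<longleftrightarrow>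
      {r, q} = {a, b} \<and> (\<exists>d. (d, Some (r, q, Refuse)) \<in> set h)" for r q
  proof -
    have "Some (r, q, Refuse) \<in> set (bilateral_history b (private_history g a h)) \<longleftrightarrow>
        (\<exists>x\<in>set h. involving b (involving a (snd x)) = Some (r, q, Refuse))"
      unfolding bilateral_history_eq by (auto simp: image_iff eq_commute[of "Some _"])
    then show ?thesis by (force simp: involving_involving[OF assms])
  qed
  then show ?thesis unfolding clean_def by (simp only: de_Morgan_conj not_ex imp_conv_disj disj_commute all_simps)
qed

section \<open>Evolution of the network\<close>

lemma current_network_Nil [simp]: "current_network g [] = g"
  by (simp add: current_network_def)

lemma current_network_snoc [simp]:
  "current_network g (h @ [(d, m)]) = prune (current_network g h) d"
  by (simp add: current_network_def)

lemma prune_iff: "{a, b} \<in> prune G d \<longleftrightarrow> {a, b} \<in> G \<and> d (a, b) = Keep \<and> d (b, a) = Keep"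
  by (auto simp: prune_def doubleton_eq_iff insert_commute)

lemma prune_subset: "prune G d \<subseteq> G"
  by (auto simp: prune_def)

lemma network_eqI:
  fixes G G' :: "'b set set"
  assumes "network G" "network G'" "\<And>a b. {a, b} \<in> G \<longleftrightarrow> {a, b} \<in> G'"
  shows "G = G'"
proof -
  have "H \<subseteq> H'" if "network H" "\<And>a b. {a, b} \<in> H \<Longrightarrow> {a, b} \<in> H'" for H H' :: "'b set set"
  proof
    fix e assume "e \<in> H"
    then have "card e = 2" using that(1) by (auto simp: network_def)
    then obtain a b where "e = {a, b}" by (auto simp: card_2_iff)
    then show "e \<in> H'" using that(2) \<open>e \<in> H\<close> by blast
  qed
  then show ?thesis using assms by blast
qed

lemma prune_keep:
  assumes "network G" "\<And>a b. {a, b} \<in> G \<Longrightarrow> d (a, b) = Keep"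
  shows "prune G d = G"
proof (rule network_eqI)
  show "network (prune G d)" using assms(1) prune_subset network_subset by blast
  show "{a, b} \<in> prune G d \<longleftrightarrow> {a, b} \<in> G" for a b
    using assms(2)[of a b] assms(2)[of b a] by (auto simp: prune_iff insert_commute)
qed (fact assms(1))

lemma current_network_subset: "current_network g h \<subseteq> g"
proof (induction h rule: rev_induct)
  case (snoc x h)
  then show ?case using prune_subset by (cases x) (simp, blast)
qed simp

lemma network_current: "network (current_network g h)"
  by (rule network_subset[OF network_g current_network_subset])

lemma network_prune_current: "network (prune (current_network g h) d)"
  by (rule network_subset[OF network_current prune_subset])

lemma network_irrefl_prune: "{a, b} \<in> prune (current_network g h) d \<Longrightarrow> a \<noteq> b"
  by (rule network_irrefl[OF network_prune_current])

section \<open>Support and expectation of a period\<close>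

lemma set_link_decisions:
  "d \<in> set_pmf (link_decisions g \<sigma> h) \<longleftrightarrow>
    (\<forall>a b. if {a, b} \<in> current_network g h
      then d (a, b) \<in> set_pmf (fst (\<sigma> a (private_history g a h) b)) else d (a, b) = Keep)"
  unfolding link_decisions_def by (subst set_Pi_pmf) (auto simp: PiE_dflt_def)

lemma set_period:
  "set_pmf (period P g \<sigma> h) =
    {h @ [(d, None)] |d. d \<in> set_pmf (link_decisions g \<sigma> h)} \<union>
    {h @ [(d, Some (r, q, a))] |d r q a. d \<in> set_pmf (link_decisions g \<sigma> h) \<and>
       {r, q} \<in> prune (current_network g h) d \<and> a \<in> set_pmf (snd (\<sigma> q (private_history g q h) r))}"
  unfolding period_def pre_action_def
  by (auto simp: set_pmf_matching[OF network_prune_current] split: option.splits) force+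

lemma period_cases:
  assumes "h' \<in> set_pmf (period P g \<sigma> h)"
  obtains (none) d where "h' = h @ [(d, None)]" "d \<in> set_pmf (link_decisions g \<sigma> h)"
  | (some) d r q a where "h' = h @ [(d, Some (r, q, a))]" "d \<in> set_pmf (link_decisions g \<sigma> h)"
      "{r, q} \<in> prune (current_network g h) d" "a \<in> set_pmf (snd (\<sigma> q (private_history g q h) r))"
  using assms unfolding set_period by blast

lemma finite_set_pmf_period [simp]: "finite (set_pmf (period P g \<sigma> h))"
  unfolding period_def pre_action_def by (auto split: option.splits)

lemma finite_set_pmf_play [simp]: "finite (set_pmf (play P g \<sigma> h n))"
  by (induction n) auto

lemma length_play: "h' \<in> set_pmf (play P g \<sigma> h n) \<Longrightarrow> length h' = length h + n"
  by (induction n arbitrary: h') (auto elim!: period_cases)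

lemma histories_none:
  "h \<in> histories P g \<Longrightarrow> feasible_decisions g h d \<Longrightarrow> h @ [(d, None)] \<in> histories P g"
  by (rule histories.no_favor) (auto simp: set_pmf_matching[OF network_prune_current])

lemma histories_favor:
  "h \<in> histories P g \<Longrightarrow> feasible_decisions g h d \<Longrightarrow> {r, q} \<in> prune (current_network g h) d \<Longrightarrow>
    h @ [(d, Some (r, q, a))] \<in> histories P g"
  by (rule histories.favor) (auto simp: set_pmf_matching[OF network_prune_current])

lemma feasible_link_decisions: "d \<in> set_pmf (link_decisions g \<sigma> h) \<Longrightarrow> feasible_decisions g h d"
  by (auto simp: set_link_decisions feasible_decisions_def)

lemma period_histories:
  "h \<in> histories P g \<Longrightarrow> h' \<in> set_pmf (period P g \<sigma> h) \<Longrightarrow> h' \<in> histories P g"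
  by (auto elim!: period_cases intro!: histories_none histories_favor feasible_link_decisions)

lemma play_histories:
  "h \<in> histories P g \<Longrightarrow> h' \<in> set_pmf (play P g \<sigma> h n) \<Longrightarrow> h' \<in> histories P g"
  by (induction n arbitrary: h') (auto intro: period_histories)

text \<open>The conditional expectation of \<open>F\<close> at the end of the period once decisions
  and matching are known; only the provider's action is still random.\<close>

definition node_value :: "'n profile \<Rightarrow> 'n history \<Rightarrow> 'n decisions \<Rightarrow> ('n history \<Rightarrow> real) \<Rightarrow> ('n \<times> 'n) option \<Rightarrow> real" where
  "node_value \<sigma> h d F m = (case m of
       None \<Rightarrow> F (h @ [(d, None)])
     | Some (r, q) \<Rightarrow> measure_pmf.expectation (snd (\<sigma> q (private_history g q h) r))
         (\<lambda>a. F (h @ [(d, Some (r, q, a))])))"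

lemma expectation_period:
  "measure_pmf.expectation (period P g \<sigma> h) F =
    measure_pmf.expectation (link_decisions g \<sigma> h) (\<lambda>d.
      measure_pmf.expectation (matching P (prune (current_network g h) d)) (node_value \<sigma> h d F))"
  unfolding period_def pre_action_def bind_assoc_pmf bind_map_pmf
proof (subst expectation_bind_finite)
  fix d
  show "finite (set_pmf (matching P (prune (current_network g h) d) \<bind>
       (\<lambda>m. case (d, m) of (d, m) \<Rightarrow> (case m of
         None \<Rightarrow> return_pmf (h @ [(d, None)])
       | Some (r, q) \<Rightarrow> map_pmf (\<lambda>a. h @ [(d, Some (r, q, a))]) (snd (\<sigma> q (private_history g q h) r))))))"
    by (auto split: option.splits)
next
  show "measure_pmf.expectation (link_decisions g \<sigma> h) (\<lambda>d. measure_pmf.expectation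
      (matching P (prune (current_network g h) d) \<bind> (\<lambda>m. case (d, m) of (d, m) \<Rightarrow> (case m of
         None \<Rightarrow> return_pmf (h @ [(d, None)])
       | Some (r, q) \<Rightarrow> map_pmf (\<lambda>a. h @ [(d, Some (r, q, a))]) (snd (\<sigma> q (private_history g q h) r))))) F)
    = measure_pmf.expectation (link_decisions g \<sigma> h) (\<lambda>d.
      measure_pmf.expectation (matching P (prune (current_network g h) d)) (node_value \<sigma> h d F))"
    by (intro expectation_cong_pmf, subst expectation_bind_finite)
       (auto simp: node_value_def split: option.splits intro!: expectation_cong_pmf)
qed simp

section \<open>Discounted payoffs by verification\<close>

lemma play_invariant:
  assumes "\<And>h h'. Inv h \<Longrightarrow> h' \<in> set_pmf (period P g \<sigma> h) \<Longrightarrow> Inv h'" "Inv h"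
    and "h' \<in> set_pmf (play P g \<sigma> h n)"
  shows "Inv h'"
  using assms(3) by (induction n arbitrary: h') (use assms(1,2) in auto)

text \<open>The verification argument: if \<open>\<phi>\<close> satisfies the Bellman inequality on
  a set of histories closed under play, iterating it \<open>N\<close> times bounds the truncated sum
  plus the discounted remainder. An arbitrary \<open>f\<close> is allowed so that negated payoffs
  are covered as well.\<close>

lemma discounted_sum_le:
  fixes f :: "'n interaction \<Rightarrow> real"
  assumes step: "\<And>h. Inv h \<Longrightarrow>
      measure_pmf.expectation (period P g \<sigma> h) (\<lambda>h'. f (snd (last h')) + \<delta> * \<phi> h') \<le> \<phi> h"
    and inv: "\<And>h h'. Inv h \<Longrightarrow> h' \<in> set_pmf (period P g \<sigma> h) \<Longrightarrow> Inv h'" and "Inv h"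
  shows "(\<Sum>n<N. \<delta> ^ n * measure_pmf.expectation (play P g \<sigma> h (Suc n)) (\<lambda>h'. f (snd (last h'))))
      + \<delta> ^ N * measure_pmf.expectation (play P g \<sigma> h N) \<phi> \<le> \<phi> h"
proof (induction N)
  case 0
  then show ?case by simp
next
  case (Suc N)
  let ?E = "\<lambda>n. measure_pmf.expectation (play P g \<sigma> h n)"
  have "?E (Suc N) (\<lambda>h'. f (snd (last h'))) + \<delta> * ?E (Suc N) \<phi>
      = ?E (Suc N) (\<lambda>h'. f (snd (last h')) + \<delta> * \<phi> h')"
    by (subst Bochner_Integration.integral_add)
       (simp_all add: integrable_measure_pmf_finite del: play.simps)
  also have "\<dots> = ?E N (\<lambda>h'. measure_pmf.expectation (period P g \<sigma> h') (\<lambda>h'. f (snd (last h')) + \<delta> * \<phi> h'))"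
    by (simp add: expectation_bind_finite)
  also have "\<dots> \<le> ?E N \<phi>"
  proof (rule expectation_mono_finite)
    fix h' assume "h' \<in> set_pmf (play P g \<sigma> h N)"
    with inv \<open>Inv h\<close> have "Inv h'" by (rule play_invariant[of Inv])
    then show "measure_pmf.expectation (period P g \<sigma> h') (\<lambda>h'. f (snd (last h')) + \<delta> * \<phi> h') \<le> \<phi> h'"
      by (rule step)
  qed simp
  finally have "\<delta> ^ N * (?E (Suc N) (\<lambda>h'. f (snd (last h'))) + \<delta> * ?E (Suc N) \<phi>) \<le> \<delta> ^ N * ?E N \<phi>"
    using params_simps by (intro mult_left_mono) auto
  then show ?case using Suc by (simp add: algebra_simps del: play.simps)
qed

text \<open>The remainder is at least \<open>- K * \<delta> ^ N\<close>, so it cannot make the limit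
  of the truncated bounds smaller.\<close>

lemma discounted_suminf_le:
  fixes f :: "'n interaction \<Rightarrow> real"
  assumes step: "\<And>h. Inv h \<Longrightarrow>
      measure_pmf.expectation (period P g \<sigma> h) (\<lambda>h'. f (snd (last h')) + \<delta> * \<phi> h') \<le> \<phi> h"
    and inv: "\<And>h h'. Inv h \<Longrightarrow> h' \<in> set_pmf (period P g \<sigma> h) \<Longrightarrow> Inv h'" and "Inv h"
    and K: "\<And>h. \<bar>\<phi> h\<bar> \<le> K"
    and summable: "summable (\<lambda>n. \<delta> ^ n * measure_pmf.expectation (play P g \<sigma> h (Suc n)) (\<lambda>h'. f (snd (last h'))))"
  shows "(\<Sum>n. \<delta> ^ n * measure_pmf.expectation (play P g \<sigma> h (Suc n)) (\<lambda>h'. f (snd (last h')))) \<le> \<phi> h"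
proof -
  let ?a = "\<lambda>n. \<delta> ^ n * measure_pmf.expectation (play P g \<sigma> h (Suc n)) (\<lambda>h'. f (snd (last h')))"
  have lower: "- K \<le> measure_pmf.expectation (play P g \<sigma> h N) \<phi>" for N
  proof -
    have "measure_pmf.expectation (play P g \<sigma> h N) (\<lambda>_. - K) \<le> measure_pmf.expectation (play P g \<sigma> h N) \<phi>"
      by (rule expectation_mono_finite) (use K in \<open>auto simp: abs_le_iff minus_le_iff\<close>)
    then show ?thesis by simp
  qed
  have "(\<Sum>n<N. ?a n) + \<delta> ^ N * (- K) \<le> \<phi> h" for N
  proof -
    have "(\<Sum>n<N. ?a n) + \<delta> ^ N * (- K) \<le> (\<Sum>n<N. ?a n) + \<delta> ^ N * measure_pmf.expectation (play P g \<sigma> h N) \<phi>"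
      using lower params_simps by (intro add_left_mono mult_left_mono) auto
    also have "\<dots> \<le> \<phi> h" by (rule discounted_sum_le[where Inv = Inv]) fact+
    finally show ?thesis .
  qed
  moreover have "(\<lambda>N. (\<Sum>n<N. ?a n) + \<delta> ^ N * (- K)) \<longlonglongrightarrow> suminf ?a + 0 * (- K)"
    by (intro tendsto_intros summable_LIMSEQ summable LIMSEQ_power_zero) (use params_simps in auto)
  ultimately show ?thesis
    by (intro LIMSEQ_le_const2[of _ "suminf ?a"]) auto
qed

lemma abs_period_payoff_le: "\<bar>period_payoff P (i :: 'n) m\<bar> \<le> v"
  using params_simps by (auto simp: period_payoff_def split: option.splits action.splits)

lemma abs_expected_payoff_le:
  "\<bar>measure_pmf.expectation (play P g \<sigma> h n) (\<lambda>h'. period_payoff P i (snd (last h')))\<bar> \<le> v"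
proof -
  have "- v = measure_pmf.expectation (play P g \<sigma> h n) (\<lambda>_. - v)" by simp
  also have "\<dots> \<le> measure_pmf.expectation (play P g \<sigma> h n) (\<lambda>h'. period_payoff P i (snd (last h')))"
    using abs_period_payoff_le by (intro expectation_mono_finite) (auto simp: abs_le_iff minus_le_iff)
  finally have "- v \<le> \<dots>" .
  moreover have "measure_pmf.expectation (play P g \<sigma> h n) (\<lambda>h'. period_payoff P i (snd (last h'))) \<le> v"
    using abs_period_payoff_le by (intro expectation_le_const) (auto simp: abs_le_iff)
  ultimately show ?thesis by linarith
qed

lemma summable_payoff:
  "summable (\<lambda>n. \<delta> ^ n * measure_pmf.expectation (play P g \<sigma> h (Suc n)) (\<lambda>h'. period_payoff P i (snd (last h'))))"
proof (rule summable_comparison_test')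
  show "summable (\<lambda>n. \<delta> ^ n * v)"
    using params_simps by (intro summable_mult2 summable_geometric) auto
  show "norm (\<delta> ^ n * measure_pmf.expectation (play P g \<sigma> h (Suc n)) (\<lambda>h'. period_payoff P i (snd (last h'))))
      \<le> \<delta> ^ n * v" for n
    using params_simps abs_expected_payoff_le unfolding real_norm_def abs_mult
    by (intro mult_mono) (auto simp del: play.simps)
qed

text \<open>Since the profile is arbitrary, this bounds deviations of any duration at once and
  stands in for a one-shot deviation principle.\<close>

lemma continuation_payoff_le:
  assumes "\<And>h. Inv h \<Longrightarrow>
      measure_pmf.expectation (period P g \<sigma> h) (\<lambda>h'. period_payoff P i (snd (last h')) + \<delta> * \<phi> h') \<le> \<phi> h"
    and "\<And>h h'. Inv h \<Longrightarrow> h' \<in> set_pmf (period P g \<sigma> h) \<Longrightarrow> Inv h'" and "Inv h"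
    and "\<And>h. \<bar>\<phi> h\<bar> \<le> K"
  shows "continuation_payoff P g \<sigma> i h \<le> \<phi> h"
  unfolding continuation_payoff_def
  by (rule discounted_suminf_le[where Inv = Inv and K = K and f = "period_payoff P i" and \<phi> = \<phi>])
     (fact assms summable_payoff)+

lemma continuation_payoff_eq:
  assumes step: "\<And>h. Inv h \<Longrightarrow>
      measure_pmf.expectation (period P g \<sigma> h) (\<lambda>h'. period_payoff P i (snd (last h')) + \<delta> * \<phi> h') = \<phi> h"
    and inv: "\<And>h h'. Inv h \<Longrightarrow> h' \<in> set_pmf (period P g \<sigma> h) \<Longrightarrow> Inv h'" and "Inv h"
    and K: "\<And>h. \<bar>\<phi> h\<bar> \<le> K"
  shows "continuation_payoff P g \<sigma> i h = \<phi> h"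
proof (rule antisym)
  show "continuation_payoff P g \<sigma> i h \<le> \<phi> h"
    by (rule continuation_payoff_le[where Inv = Inv and K = K and \<phi> = \<phi>])
       (use step in simp, (fact assms)+)
  \<comment> \<open>The reverse inequality is the same verification applied to negated payoffs and
    \<open>- \<phi>\<close>.\<close>
  have "(\<Sum>n. \<delta> ^ n * measure_pmf.expectation (play P g \<sigma> h (Suc n)) (\<lambda>h'. - period_payoff P i (snd (last h'))))
      \<le> - \<phi> h"
  proof (rule discounted_suminf_le[where Inv = Inv and K = K and \<phi> = "\<lambda>h. - \<phi> h"])
    fix h assume "Inv h"
    have "measure_pmf.expectation (period P g \<sigma> h) (\<lambda>h'. - period_payoff P i (snd (last h')) + \<delta> * - \<phi> h')
       = measure_pmf.expectation (period P g \<sigma> h) (\<lambda>h'. - (period_payoff P i (snd (last h')) + \<delta> * \<phi> h'))"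
      by (rule expectation_cong_pmf) simp
    also have "\<dots> = - \<phi> h" using step[OF \<open>Inv h\<close>] by (subst Bochner_Integration.integral_minus) simp
    finally show "measure_pmf.expectation (period P g \<sigma> h) (\<lambda>h'. - period_payoff P i (snd (last h')) + \<delta> * - \<phi> h') \<le> - \<phi> h"
      by simp
  next
    show "summable (\<lambda>n. \<delta> ^ n * measure_pmf.expectation (play P g \<sigma> h (Suc n)) (\<lambda>h'. - period_payoff P i (snd (last h'))))"
      using summable_minus[OF summable_payoff] by (simp del: play.simps)
    show "Inv h" by fact
    show "Inv h'" if "Inv h" "h' \<in> set_pmf (period P g \<sigma> h)" for h h' using that by (rule inv)
    show "\<bar>- \<phi> h\<bar> \<le> K" for h using K by simp
  qed
  then show "\<phi> h \<le> continuation_payoff P g \<sigma> i h"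
    unfolding continuation_payoff_def using suminf_minus[OF summable_payoff[of \<sigma> h i]]
    by (simp del: play.simps)
qed

end

section \<open>Necessity\<close>

locale stable_profile = favor_exchange P g for P :: "'f favor_params" and g :: "'n::finite set set" +
  fixes \<sigma> :: "'n profile"
  assumes stable: "stable_bilateral_equilibrium P g \<sigma>"
begin

section \<open>Behavior forced along the equilibrium path\<close>

lemma on_path:
  assumes "h \<in> set_pmf (play P g \<sigma> [] n)" "(d, m) \<in> set h"
  shows "\<And>a b. {a, b} \<in> g \<Longrightarrow> d (a, b) = Keep" "\<And>r q x. m = Some (r, q, x) \<Longrightarrow> x = Provide"
  using stable assms unfolding stable_bilateral_equilibrium_def by blast+

text \<open>A script for nature: the prescribed interactions take place while everybody keeps all
  links.\<close>

definition path_history :: "'n interaction list \<Rightarrow> 'n history" where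
  "path_history ms = map (\<lambda>m. (\<lambda>_. Keep, m)) ms"

definition cooperative :: "'n interaction \<Rightarrow> bool" where
  "cooperative m \<longleftrightarrow> (\<forall>r q x. m = Some (r, q, x) \<longrightarrow> {r, q} \<in> g \<and> x = Provide)"

lemma current_path_history: "current_network g (path_history ms) = g"
proof (induction ms rule: rev_induct)
  case (snoc m ms)
  then show ?case using prune_keep[OF network_g] by (simp add: path_history_def)
qed (simp add: path_history_def)

text \<open>An idle period can follow any decision that has positive probability, which makes the
  extended history part of equilibrium play; stability then excludes removals.\<close>

lemma link_decisions_path_history:
  assumes "path_history ms \<in> set_pmf (play P g \<sigma> [] (length ms))"
    and "d \<in> set_pmf (link_decisions g \<sigma> (path_history ms))"
  shows "d = (\<lambda>_. Keep)"
proof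
  fix x :: "'n \<times> 'n"
  obtain a b where x: "x = (a, b)" by (cases x)
  have "path_history ms @ [(d, None)] \<in> set_pmf (play P g \<sigma> [] (Suc (length ms)))"
    using assms by (auto simp: set_period)
  then have "{a, b} \<in> g \<Longrightarrow> d (a, b) = Keep"
    by (rule on_path(1)[where m = None]) auto
  moreover have "{a, b} \<notin> g \<Longrightarrow> d (a, b) = Keep"
    using assms(2) by (auto simp: set_link_decisions current_path_history)
  ultimately show "d x = Keep" using x by blast
qed

lemma action_path_history:
  assumes "path_history ms \<in> set_pmf (play P g \<sigma> [] (length ms))" "{r, q} \<in> g"
    and "x \<in> set_pmf (snd (\<sigma> q (private_history g q (path_history ms)) r))"
  shows "x = Provide"
proof -
  obtain d where d: "d \<in> set_pmf (link_decisions g \<sigma> (path_history ms))"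
    by (rule exE[OF set_pmf_exists])
  have "prune g d = g"
    using link_decisions_path_history[OF assms(1) d] prune_keep[OF network_g] by simp
  then have "path_history ms @ [(d, Some (r, q, x))] \<in> set_pmf (play P g \<sigma> [] (Suc (length ms)))"
    using assms d by (auto simp: set_period current_path_history)
  then show ?thesis by (rule on_path(2)[where d = d]) auto
qed

text \<open>Nature can produce any sequence of favors along links of \<open>g\<close>, and at each
  stage the previous two lemmas leave only keeping and providing in the support.\<close>

lemma path_history_in_play:
  assumes "\<forall>m\<in>set ms. cooperative m"
  shows "path_history ms \<in> set_pmf (play P g \<sigma> [] (length ms))"
  using assms
proof (induction ms rule: rev_induct)
  case (snoc m ms)
  let ?h = "path_history ms"
  have h: "?h \<in> set_pmf (play P g \<sigma> [] (length ms))" using snoc by auto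
  obtain d where d: "d \<in> set_pmf (link_decisions g \<sigma> ?h)"
    by (rule exE[OF set_pmf_exists])
  have dK: "d = (\<lambda>_. Keep)" by (rule link_decisions_path_history) fact+
  have prune: "prune g d = g" using dK prune_keep[OF network_g] by simp
  have "?h @ [(d, m)] \<in> set_pmf (period P g \<sigma> ?h)"
  proof (cases m)
    case None
    then show ?thesis using d by (auto simp: set_period)
  next
    case (Some y)
    obtain r q x where y: "y = (r, q, x)" by (cases y)
    then have *: "{r, q} \<in> g" "x = Provide" using Some snoc.prems by (auto simp: cooperative_def)
    obtain x' where "x' \<in> set_pmf (snd (\<sigma> q (private_history g q ?h) r))"
      by (rule exE[OF set_pmf_exists])
    moreover from this have "x' = Provide" by (rule action_path_history[OF h *(1)])
    ultimately show ?thesis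
      using d Some y * prune by (auto simp: set_period current_path_history)
  qed
  then have "?h @ [(d, m)] \<in> set_pmf (play P g \<sigma> [] (Suc (length ms)))" using h by auto
  then show ?case using dK by (simp add: path_history_def)
qed (simp add: path_history_def)

lemma path_history_behavior:
  assumes "\<forall>m\<in>set ms. cooperative m" "{a, b} \<in> g"
  shows "\<sigma> a (private_history g a (path_history ms)) b = (return_pmf Keep, return_pmf Provide)"
proof -
  let ?h = "path_history ms"
  have h: "?h \<in> set_pmf (play P g \<sigma> [] (length ms))" by (rule path_history_in_play) fact
  have "x = Keep" if x: "x \<in> set_pmf (fst (\<sigma> a (private_history g a ?h) b))" for x
  proof -
    obtain d where "d \<in> set_pmf (link_decisions g \<sigma> ?h)" by (rule exE[OF set_pmf_exists])
    \<comment> \<open>Randomizations over different links are independent, so one coordinate of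
      \<open>d\<close> can be replaced by any value of positive probability.\<close>
    then have "d((a, b) := x) \<in> set_pmf (link_decisions g \<sigma> ?h)"
      using x assms(2) by (auto simp: set_link_decisions current_path_history)
    then have "d((a, b) := x) = (\<lambda>_. Keep)" by (rule link_decisions_path_history[OF h])
    then show ?thesis by (metis fun_upd_same)
  qed
  then have "fst (\<sigma> a (private_history g a ?h) b) = return_pmf Keep"
    by (subst set_pmf_subset_singleton[symmetric]) auto
  moreover have "{b, a} \<in> g" using assms(2) by (simp add: insert_commute)
  then have "snd (\<sigma> a (private_history g a ?h) b) = return_pmf Provide"
    using action_path_history[OF h] by (subst set_pmf_subset_singleton[symmetric]) auto
  ultimately show ?thesis by (simp add: prod_eq_iff)
qed

text \<open>
  Every bilateral history without a refusal occurs on the equilibrium path, so measurability fixes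
  the behavior after it whatever happened on the other links.
\<close>

lemma clean_behavior:
  assumes h: "h \<in> histories P g" and ab: "{a, b} \<in> g" and clean: "clean h a b"
  shows "\<sigma> a (private_history g a h) b = (return_pmf Keep, return_pmf Provide)"
proof -
  have neq: "a \<noteq> b" using network_irrefl[OF network_g ab] .
  \<comment> \<open>The bilateral history of \<open>a\<close> and \<open>b\<close> itself serves as
    the script: all other interactions become idle periods.\<close>
  define ms where "ms = map (\<lambda>x. involving b (involving a (snd x))) h"
  have ms: "\<forall>m\<in>set ms. cooperative m"
  proof (intro ballI, unfold cooperative_def, intro allI impI)
    fix m r q x assume "m \<in> set ms" "m = Some (r, q, x)"
    then obtain d where d: "(d, Some (r, q, x)) \<in> set h" "{r, q} = {a, b}"
      by (auto simp: ms_def involving_involving[OF neq] dest: sym)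
    then have "x \<noteq> Refuse" using clean unfolding clean_def by blast
    then show "{r, q} \<in> g \<and> x = Provide" using d ab by (cases x) auto
  qed
  have "path_history ms \<in> histories P g"
    by (rule play_histories[OF histories.initial path_history_in_play[OF ms]])
  moreover have "bilateral_history b (private_history g a (path_history ms)) =
      bilateral_history b (private_history g a h)"
    unfolding bilateral_history_eq path_history_def ms_def
    by (auto simp: involving_def split: option.splits)
  ultimately have "\<sigma> a (private_history g a (path_history ms)) b = \<sigma> a (private_history g a h) b"
    using stable h neq
    unfolding stable_bilateral_equilibrium_def bilateral_equilibrium_def bilaterally_measurable_def by blast
  then show ?thesis using path_history_behavior[OF ms ab] by simp
qed

section \<open>Payoffs of conforming and of shirking\<close>

lemma equilibrium_payoff: "continuation_payoff P g \<sigma> i [] = flow_payoff P g i / (1 - \<delta>)"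
proof -
  let ?V = "flow_payoff P g i / (1 - \<delta>)"
  define Inv where "Inv h \<longleftrightarrow> h \<in> histories P g \<and> (\<forall>a b. clean h a b) \<and> current_network g h = g" for h
  have prune: "prune (current_network g h) d = g"
    if "Inv h" "d \<in> set_pmf (link_decisions g \<sigma> h)" for h d
  proof -
    have "d (a, b) = Keep" if "{a, b} \<in> g" for a b
      using clean_behavior[of h a b] that \<open>Inv h\<close>
        \<open>d \<in> _\<close>[unfolded set_link_decisions, rule_format, of a b] by (auto simp: Inv_def)
    then show ?thesis using prune_keep[OF network_g] \<open>Inv h\<close> by (simp add: Inv_def)
  qed
  have act: "snd (\<sigma> q (private_history g q h) r) = return_pmf Provide" if "Inv h" "{r, q} \<in> g" for h r q
    using clean_behavior[of h q r] that by (auto simp: Inv_def insert_commute)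
  show ?thesis
  proof (rule continuation_payoff_eq[where Inv = Inv and \<phi> = "\<lambda>_. ?V" and K = "\<bar>?V\<bar>"])
    fix h assume inv: "Inv h"
    have "measure_pmf.expectation (matching P (prune (current_network g h) d))
        (node_value \<sigma> h d (\<lambda>h'. period_payoff P i (snd (last h')) + \<delta> * ?V)) = ?V"
      if d: "d \<in> set_pmf (link_decisions g \<sigma> h)" for d
    proof -
      have "measure_pmf.expectation (matching P g) (node_value \<sigma> h d (\<lambda>h'. period_payoff P i (snd (last h')) + \<delta> * ?V))
          = measure_pmf.expectation (matching P g) (\<lambda>m. full_payoff i m + \<delta> * ?V)"
        by (rule expectation_cong_pmf)
           (auto simp: set_pmf_matching[OF network_g] node_value_def full_payoff_def act[OF inv])
      also have "\<dots> = ?V"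
        unfolding expectation_full_payoff_add[OF network_g] using params_simps by (simp add: field_simps)
      finally show ?thesis by (simp add: prune[OF inv d])
    qed
    then show "measure_pmf.expectation (period P g \<sigma> h) (\<lambda>h'. period_payoff P i (snd (last h')) + \<delta> * ?V) = ?V"
      unfolding expectation_period by (rule expectation_eq_const)
  next
    fix h h' assume inv: "Inv h" and h': "h' \<in> set_pmf (period P g \<sigma> h)"
    then have "h' \<in> histories P g" using period_histories by (auto simp: Inv_def)
    moreover have "(\<forall>a b. clean h' a b) \<and> current_network g h' = g"
      using h' by (cases rule: period_cases) (use inv prune act in \<open>auto simp: Inv_def\<close>)
    ultimately show "Inv h'" by (simp add: Inv_def)
  qed (auto simp: Inv_def histories.initial)
qed

text \<open>The link is kept as long as no refusal has occurred on it, so favors from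
  \<open>j\<close> continue to arrive; the first request by \<open>j\<close> is refused. Link
  decisions precede requests, so the removal in the next period takes effect before \<open>j\<close>
  can react.\<close>

definition shirk :: "'n \<Rightarrow> 'n \<Rightarrow> 'n strategy" where
  "shirk i j I l = (if l = j then
     (return_pmf (if \<forall>r q. Some (r, q, Refuse) \<notin> set (bilateral_history j I) then Keep else Remove),
      return_pmf Refuse) else \<sigma> i I l)"

text \<open>
  With \<open>q\<close> the probability that \<open>i\<close> is asked by \<open>j\<close>, the payoff \<open>X\<close> of shirking solves
  \<open>X = u + q (c - \<gamma> + \<delta> W) + (1 - q) \<delta> X\<close>, where \<open>u\<close> is the flow at \<open>g\<close> and \<open>W\<close> the value at \<open>g - ij\<close>.
\<close>

lemma shirk_payoff:
  assumes ij: "{i, j} \<in> g"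
  defines "q \<equiv> pmf (matching P g) (Some (j, i))"
  defines "W \<equiv> flow_payoff P (g - {{i, j}}) i / (1 - \<delta>)"
  defines "X \<equiv> (flow_payoff P g i + q * (c - \<gamma>) + \<delta> * q * W) / (1 - \<delta> * (1 - q))"
  shows "continuation_payoff P g (\<sigma>(i := shirk i j)) i [] = X"
proof -
  let ?s = "\<sigma>(i := shirk i j)"
  have neq: "i \<noteq> j" using network_irrefl[OF network_g ij] .
  have netW: "network (g - {{i, j}})" by (rule network_subset[OF network_g]) auto
  have q: "0 \<le> q" "q \<le> 1" by (simp_all add: q_def pmf_le_1)
  have "\<delta> * (1 - q) \<le> \<delta> * 1" using q params_simps by (intro mult_left_mono) auto
  then have "1 - \<delta> * (1 - q) \<noteq> 0" using params_simps by linarith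
  then have "X * (1 - \<delta> * (1 - q)) = flow_payoff P g i + q * (c - \<gamma>) + \<delta> * q * W"
    by (simp add: X_def)
  then have Xeq: "flow_payoff P g i + \<delta> * X + q * (c - \<gamma> + \<delta> * (W - X)) = X"
    by (simp add: algebra_simps)
  have Weq: "flow_payoff P (g - {{i, j}}) i + \<delta> * W = W"
    unfolding W_def using params_simps by (simp add: field_simps)
  \<comment> \<open>After a refusal the invariant leaves open whether \<open>ij\<close> is still in
    the current network, since it disappears only with the next link decisions. \<open>G h\<close>
    is the network left after those decisions.\<close>
  define Inv where "Inv h \<longleftrightarrow> h \<in> histories P g \<and> (\<forall>a b. {a, b} \<noteq> {i, j} \<longrightarrow> clean h a b) \<and>
    (\<forall>a b. {a, b} \<in> g \<longrightarrow> {a, b} \<noteq> {i, j} \<or> clean h i j \<longrightarrow> {a, b} \<in> current_network g h)" for h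
  define G where "G h = (if clean h i j then g else g - {{i, j}})" for h
  have netG: "network (G h)" for h using netW network_g by (simp add: G_def)
  have ij_shirk: "shirk i j (private_history g i h) j =
      (return_pmf (if clean h i j then Keep else Remove), return_pmf Refuse)" for h
    by (simp add: shirk_def clean_bilateral[OF neq])
  have other: "?s a (private_history g a h) b = (return_pmf Keep, return_pmf Provide)"
    if "Inv h" "{a, b} \<in> G h" "(a, b) \<noteq> (i, j)" for a b h
  proof -
    have "{a, b} \<in> g" using that(2) by (auto simp: G_def split: if_splits)
    moreover have "clean h a b"
    proof (cases "{a, b} = {i, j}")
      case True
      then have "clean h i j" using that(2) by (auto simp: G_def split: if_splits)
      then show ?thesis using True by (auto simp: doubleton_eq_iff clean_sym)
    qed (use that(1) in \<open>auto simp: Inv_def\<close>)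
    ultimately have "\<sigma> a (private_history g a h) b = (return_pmf Keep, return_pmf Provide)"
      using clean_behavior that(1) by (auto simp: Inv_def)
    then show ?thesis using that(3) by (auto simp: shirk_def)
  qed
  have prune: "prune (current_network g h) d = G h"
    if inv: "Inv h" and d: "d \<in> set_pmf (link_decisions g ?s h)" for h d
  proof (rule network_eqI[OF network_prune_current netG])
    fix a b
    have keep: "d (x, y) = Keep" if "{x, y} \<in> G h" for x y
    proof -
      have "{x, y} \<in> current_network g h"
        using that inv unfolding Inv_def G_def by (auto split: if_splits)
      then have "d (x, y) \<in> set_pmf (fst (?s x (private_history g x h) y))"
        using d by (simp only: set_link_decisions split: if_splits)
      then show ?thesis
      proof (cases "(x, y) = (i, j)")
        case True
        then have "clean h i j" using that by (auto simp: G_def split: if_splits)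
        then show ?thesis using True \<open>d (x, y) \<in> _\<close> by (simp add: ij_shirk)
      next
        case False
        then show ?thesis using other[OF inv that False] \<open>d (x, y) \<in> _\<close> by simp
      qed
    qed
    show "{a, b} \<in> prune (current_network g h) d \<longleftrightarrow> {a, b} \<in> G h"
    proof
      assume ab: "{a, b} \<in> prune (current_network g h) d"
      then have *: "{a, b} \<in> current_network g h" "d (a, b) = Keep" "d (b, a) = Keep" by (auto simp: prune_iff)
      have "clean h i j" if "{a, b} = {i, j}"
      proof (rule ccontr)
        assume "\<not> clean h i j"
        moreover have "{i, j} \<in> current_network g h" "d (i, j) = Keep"
          using * that by (auto simp: doubleton_eq_iff)
        ultimately show False
          using d[unfolded set_link_decisions, rule_format, of i j] by (simp add: ij_shirk)
      qed
      then show "{a, b} \<in> G h" using *(1) current_network_subset unfolding G_def by auto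
    next
      assume "{a, b} \<in> G h"
      moreover from this have "{b, a} \<in> G h" by (simp add: insert_commute)
      moreover have "{a, b} \<in> current_network g h"
        using \<open>{a, b} \<in> G h\<close> inv unfolding Inv_def G_def by (auto split: if_splits)
      ultimately show "{a, b} \<in> prune (current_network g h) d" using keep by (simp add: prune_iff)
    qed
  qed
  have act: "snd (?s b (private_history g b h) a) = return_pmf (if (a, b) = (j, i) then Refuse else Provide)"
    if "Inv h" "{a, b} \<in> G h" for h a b
  proof (cases "(a, b) = (j, i)")
    case True
    then show ?thesis by (simp add: ij_shirk)
  next
    case False
    moreover have "{b, a} \<in> G h" using that by (simp add: insert_commute)
    ultimately show ?thesis using other[OF that(1), of b a] by auto
  qed
  define \<phi> where "\<phi> h = (if clean h i j then X else W)" for h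
  have "continuation_payoff P g ?s i [] = \<phi> []"
  proof (rule continuation_payoff_eq[where Inv = Inv and \<phi> = \<phi> and K = "\<bar>X\<bar> + \<bar>W\<bar>"])
    fix h assume inv: "Inv h"
    let ?F = "\<lambda>h'. period_payoff P i (snd (last h')) + \<delta> * \<phi> h'"
    have "measure_pmf.expectation (matching P (prune (current_network g h) d)) (node_value ?s h d ?F) = \<phi> h"
      if d: "d \<in> set_pmf (link_decisions g ?s h)" for d
    proof (cases "clean h i j")
      case True
      \<comment> \<open>The correction to cooperative play in the one event in which
        \<open>j\<close> asks \<open>i\<close>: the cost falls from \<open>c\<close> to
        \<open>\<gamma>\<close>, and the continuation changes from \<open>X\<close> to
        \<open>W\<close>.\<close>
      let ?k = "c - \<gamma> + \<delta> * (W - X)"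
      have G: "G h = g" using True by (simp add: G_def)
      have "measure_pmf.expectation (matching P g) (node_value ?s h d ?F) =
          measure_pmf.expectation (matching P g) (\<lambda>m. (full_payoff i m + \<delta> * X) + ?k * indicator {Some (j, i)} m)"
      proof (rule expectation_cong_pmf)
        fix m assume "m \<in> set_pmf (matching P g)"
        then consider "m = None" | r p where "m = Some (r, p)" "{r, p} \<in> G h"
          unfolding set_pmf_matching[OF network_g] G by blast
        then show "node_value ?s h d ?F m = (full_payoff i m + \<delta> * X) + ?k * indicator {Some (j, i)} m"
        proof cases
          case 1
          then show ?thesis using True by (simp add: node_value_def full_payoff_def \<phi>_def)
        next
          case 2
          show ?thesis
          proof (cases "(r, p) = (j, i)")
            case eq: True
            then show ?thesis using True act[OF inv 2(2)] neq 2(1)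
              by (simp add: node_value_def full_payoff_def \<phi>_def insert_commute period_payoff_def algebra_simps)
          next
            case False
            then have "snd (?s p (private_history g p h) r) = return_pmf Provide"
              using act[OF inv 2(2)] by (simp only: if_False)
            moreover have "indicator {Some (j, i)} m = (0 :: real)" using False 2(1) by auto
            ultimately show ?thesis using True 2(1)
              by (simp add: node_value_def full_payoff_def \<phi>_def)
          qed
        qed
      qed
      also have "\<dots> = flow_payoff P g i + \<delta> * X + ?k * q"
        unfolding q_def
        by (subst Bochner_Integration.integral_add)
           (simp_all add: integrable_measure_pmf_finite expectation_full_payoff_add[OF network_g] measure_pmf_single)
      also have "\<dots> = X" using Xeq by (simp add: algebra_simps)
      finally show ?thesis using True by (simp add: prune[OF inv d] G \<phi>_def)
    next
      case False
      have G: "G h = g - {{i, j}}" using False by (simp add: G_def)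
      have "measure_pmf.expectation (matching P (G h)) (node_value ?s h d ?F) =
          measure_pmf.expectation (matching P (G h)) (\<lambda>m. full_payoff i m + \<delta> * W)"
      proof (rule expectation_cong_pmf)
        fix m assume "m \<in> set_pmf (matching P (G h))"
        then consider "m = None" | r p where "m = Some (r, p)" "{r, p} \<in> G h"
          unfolding set_pmf_matching[OF netG] by blast
        then show "node_value ?s h d ?F m = full_payoff i m + \<delta> * W"
        proof cases
          case 1
          then show ?thesis using False by (simp add: node_value_def full_payoff_def \<phi>_def)
        next
          case 2
          then have "(r, p) \<noteq> (j, i)" by (auto simp: G insert_commute)
          then have "snd (?s p (private_history g p h) r) = return_pmf Provide"
            using act[OF inv 2(2)] by (simp only: if_False)
          then show ?thesis using False 2(1)
            by (simp add: node_value_def full_payoff_def \<phi>_def)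
        qed
      qed
      also have "\<dots> = W" unfolding expectation_full_payoff_add[OF netG] using Weq by (simp add: G)
      finally show ?thesis using False by (simp add: prune[OF inv d] \<phi>_def)
    qed
    then show "measure_pmf.expectation (period P g ?s h) ?F = \<phi> h"
      unfolding expectation_period by (rule expectation_eq_const)
  next
    fix h h' assume inv: "Inv h" and h': "h' \<in> set_pmf (period P g ?s h)"
    have hist: "h' \<in> histories P g" using inv h' period_histories by (auto simp: Inv_def)
    from h' show "Inv h'"
    proof (cases rule: period_cases)
      case (none d)
      then show ?thesis using inv hist prune[OF inv none(2)] by (auto simp: Inv_def G_def)
    next
      case (some d r q a)
      then have rq: "{r, q} \<in> G h" using prune[OF inv some(2)] by simp
      have a: "a = (if (r, q) = (j, i) then Refuse else Provide)" using some(4) act[OF inv rq] by simp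
      show ?thesis
      proof (cases "(r, q) = (j, i)")
        case True
        then show ?thesis using inv hist some(1) prune[OF inv some(2)] a
          by (auto simp: Inv_def G_def insert_commute split: if_splits)
      next
        case False
        then show ?thesis using inv hist some(1) prune[OF inv some(2)] a
          by (auto simp: Inv_def G_def split: if_splits)
      qed
    qed
  qed (auto simp: Inv_def histories.initial \<phi>_def)
  then show ?thesis by (simp add: \<phi>_def)
qed

text \<open>Only the empty history has length zero, so the Bayesian beliefs there are point masses
  for every tremble and so is their limit. Optimality against beliefs becomes a plain comparison of
  payoffs.\<close>

lemma equilibrium_beats:
  "continuation_payoff P g (\<sigma>(i := \<tau>)) i [] \<le> continuation_payoff P g \<sigma> i []"
proof -
  obtain \<mu> \<nu> where eq: "sequentially_rational P g \<sigma> \<mu> \<nu>" "consistent P g \<sigma> \<mu> \<nu>"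
    using stable unfolding stable_bilateral_equilibrium_def bilateral_equilibrium_def
      sequential_equilibrium_def by blast
  let ?I = "private_history g i []"
  obtain s where "pmf_converges (\<lambda>k. bayes_link P g (s k) i ?I) (\<mu> i ?I)"
    using eq(2) histories.initial unfolding consistent_def Let_def by blast
  moreover have "bayes_link P g (s k) i ?I = return_pmf []" for k
  proof -
    have "bayes_link P g (s k) i ?I = cond_pmf (return_pmf []) {h. private_history g i h = ?I}"
      by (simp add: bayes_link_def private_history_def)
    moreover have "set_pmf (return_pmf []) \<inter> {h. private_history g i h = ?I} \<noteq> {}" by simp
    ultimately have "set_pmf (bayes_link P g (s k) i ?I) \<subseteq> {[]}"
      by (simp add: set_cond_pmf)
    then show ?thesis by (simp add: set_pmf_subset_singleton)
  qed
  ultimately have "\<mu> i ?I = return_pmf []"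
    by (intro pmf_eqI) (simp add: pmf_converges_def LIMSEQ_const_iff)
  moreover have "measure_pmf.expectation (\<mu> i ?I) (continuation_payoff P g (\<sigma>(i := \<tau>)) i)
      \<le> measure_pmf.expectation (\<mu> i ?I) (continuation_payoff P g \<sigma> i)"
    using eq(1) histories.initial unfolding sequentially_rational_def Let_def by blast
  ultimately show ?thesis by simp
qed

text \<open>Conforming and shirking differ only once \<open>j\<close> has asked, so the comparison
  of their values reduces to an inequality with the common factor \<open>q\<close>; as
  \<open>ij\<close> is a link, \<open>q > 0\<close> and it cancels.\<close>

lemma endpoint_sustainable:
  assumes ij: "{i, j} \<in> g"
  shows "\<delta> / (1 - \<delta>) * flow_payoff P g i - \<delta> / (1 - \<delta>) * flow_payoff P (g - {{i, j}}) i \<ge> c - \<gamma>"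
proof -
  define q where "q = pmf (matching P g) (Some (j, i))"
  define u where "u = flow_payoff P g i"
  define W where "W = flow_payoff P (g - {{i, j}}) i / (1 - \<delta>)"
  define V where "V = u / (1 - \<delta>)"
  have "Some (j, i) \<in> set_pmf (matching P g)"
    using ij by (auto simp: set_pmf_matching[OF network_g] insert_commute)
  then have q: "0 < q" "q \<le> 1" by (simp_all add: q_def pmf_positive pmf_le_1)
  have d: "0 < 1 - \<delta> * (1 - q)"
  proof -
    have "\<delta> * (1 - q) \<le> \<delta> * 1" using q params_simps by (intro mult_left_mono) auto
    then show ?thesis using params_simps by linarith
  qed
  have "(u + q * (c - \<gamma>) + \<delta> * q * W) / (1 - \<delta> * (1 - q)) \<le> V"
    using equilibrium_beats[of i "shirk i j"] unfolding shirk_payoff[OF ij] equilibrium_payoff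
    by (simp add: q_def u_def W_def V_def)
  then have "u + q * (c - \<gamma>) + \<delta> * q * W \<le> V * (1 - \<delta> * (1 - q))"
    using d by (simp add: pos_divide_le_eq)
  also have "\<dots> = u + \<delta> * q * V"
  proof -
    have "V * (1 - \<delta>) = u" unfolding V_def using params_simps by simp
    then show ?thesis by (simp add: algebra_simps)
  qed
  finally have "q * (c - \<gamma>) \<le> q * (\<delta> * V - \<delta> * W)" by (simp add: algebra_simps)
  then have "c - \<gamma> \<le> \<delta> * V - \<delta> * W" using q by simp
  then show ?thesis by (simp add: V_def W_def u_def)
qed

lemma stable_links_sustainable: "e \<in> g \<Longrightarrow> sustainable P g e"
proof -
  assume e: "e \<in> g"
  then obtain a b where ab: "e = {a, b}"
    using network_g unfolding network_def card_2_iff by blast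
  then show "sustainable P g e"
    using endpoint_sustainable[of a b] endpoint_sustainable[of b a] e
    by (auto simp: sustainable_def insert_commute)
qed

end

section \<open>Trigger strategies\<close>

context favor_exchange
begin

text \<open>The same error probability is used at every information set. After a breach both sides
  remove the link; as one removal suffices, the decision of the other has no effect on the network.
  The test is on the bilateral history because a strategy has access to the private history
  only.\<close>

definition trigger :: "real \<Rightarrow> 'n profile" where
  "trigger \<epsilon> a I b = (if \<forall>r q. Some (r, q, Refuse) \<notin> set (bilateral_history b I)
     then (tremble \<epsilon> Keep Remove, tremble \<epsilon> Provide Refuse)
     else (tremble \<epsilon> Remove Keep, tremble \<epsilon> Refuse Provide))"

lemma trigger_eq:
  assumes "a \<noteq> b"
  shows "trigger \<epsilon> a (private_history g a h) b = (if clean h a b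
     then (tremble \<epsilon> Keep Remove, tremble \<epsilon> Provide Refuse)
     else (tremble \<epsilon> Remove Keep, tremble \<epsilon> Refuse Provide))"
  by (simp add: trigger_def clean_bilateral[OF assms])

lemma trigger_0_eq:
  assumes "a \<noteq> b"
  shows "trigger 0 a (private_history g a h) b = (if clean h a b
     then (return_pmf Keep, return_pmf Provide) else (return_pmf Remove, return_pmf Refuse))"
  by (simp add: trigger_eq[OF assms])

section \<open>Quiet histories and the value of a set of links\<close>

definition quiet_decisions :: "'n \<Rightarrow> 'n decisions \<Rightarrow> bool" where
  "quiet_decisions i d \<longleftrightarrow> (\<forall>a b. a \<noteq> i \<longrightarrow> b \<noteq> i \<longrightarrow> d (a, b) = Keep)"

definition quiet_interaction :: "'n \<Rightarrow> 'n interaction \<Rightarrow> bool" where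
  "quiet_interaction i m \<longleftrightarrow> (\<forall>r q. m = Some (r, q, Refuse) \<longrightarrow> r = i \<or> q = i)"

text \<open>This describes what \<open>i\<close> believes in the limit: any mistakes so far were
  made on links of \<open>i\<close>, by her or by her partners.\<close>

definition quiet :: "'n \<Rightarrow> 'n history \<Rightarrow> bool" where
  "quiet i h \<longleftrightarrow> (\<forall>(d, m)\<in>set h. quiet_decisions i d \<and> quiet_interaction i m)"

lemma quiet_Nil [simp]: "quiet i []"
  by (simp add: quiet_def)

lemma quiet_snoc: "quiet i (h @ [(d, m)]) \<longleftrightarrow> quiet i h \<and> quiet_decisions i d \<and> quiet_interaction i m"
  by (auto simp: quiet_def)

lemma quiet_clean:
  assumes "quiet i h" "a \<noteq> i" "b \<noteq> i"
  shows "clean h a b"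
  unfolding clean_def
proof (intro allI impI)
  fix r q d assume "(d, Some (r, q, Refuse)) \<in> set h"
  then have "r = i \<or> q = i" using assms(1) by (auto simp: quiet_def quiet_interaction_def)
  then show "{r, q} \<noteq> {a, b}" using assms(2,3) by auto
qed

lemma quiet_link:
  assumes "quiet i h" "{a, b} \<in> g" "a \<noteq> i" "b \<noteq> i"
  shows "{a, b} \<in> current_network g h"
  using assms(1)
proof (induction h rule: rev_induct)
  case (snoc x h)
  then show ?case using assms(3,4) by (cases x) (auto simp: quiet_snoc prune_iff quiet_decisions_def)
qed (use assms(2) in simp)

text \<open>The state of the decision problem of \<open>i\<close>. A link that is present but broken
  is left out: under trigger strategies the partner removes it before it can be used again.\<close>

definition good_links :: "'n \<Rightarrow> 'n history \<Rightarrow> 'n set" where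
  "good_links i h = {j. {i, j} \<in> current_network g h \<and> clean h i j}"

text \<open>The value \<open>W T\<close> of keeping \<open>T\<close> forever. The cost shares refer
  to degrees in \<open>g\<close>, not in the current network, so that they do not vary with
  \<open>T\<close>.\<close>

definition link_value :: "'n \<Rightarrow> 'n set \<Rightarrow> real" where
  "link_value i T = (\<alpha> * v * (1 - (1 - p) ^ card T)
     - (\<Sum>j\<in>T. \<alpha> * c * (prob_able g j / real (deg g j)))) / (1 - \<delta>)"

text \<open>The link with \<open>j\<close> brings a benefit only when \<open>j\<close> alone among
  \<open>T\<close> is able, which has probability \<open>p * (1 - p) ^ (card T - 1)\<close>; its
  cost share is the same for all \<open>T\<close>. Hence the marginal value decreases in the size of
  \<open>T\<close>.\<close>

lemma value_remove:
  assumes "j \<in> T"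
  shows "link_value i T - link_value i (T - {j}) =
    (\<alpha> * v * p * (1 - p) ^ (card T - 1) - \<alpha> * c * (prob_able g j / real (deg g j))) / (1 - \<delta>)"
proof -
  have "card T \<noteq> 0" using assms by auto
  then obtain n where n: "card T = Suc n" by (cases "card T") auto
  then have n': "card (T - {j}) = n" using assms by simp
  have sum: "(\<Sum>k\<in>T. \<alpha> * c * (prob_able g k / real (deg g k))) =
     \<alpha> * c * (prob_able g j / real (deg g j)) + (\<Sum>k\<in>T - {j}. \<alpha> * c * (prob_able g k / real (deg g k)))"
    using assms by (intro sum.remove) auto
  show ?thesis
    unfolding link_value_def diff_divide_distrib[symmetric] sum n n' by (simp add: algebra_simps)
qed

text \<open>A neighbor that \<open>i\<close> still has can have lost neither the link with
  \<open>i\<close> nor any other link, so its degree is the one in \<open>g\<close>.\<close>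

lemma flow_payoff_quiet:
  assumes net: "network G" and "G \<subseteq> g" and "\<And>a b. {a, b} \<in> g \<Longrightarrow> a \<noteq> i \<Longrightarrow> b \<noteq> i \<Longrightarrow> {a, b} \<in> G"
  shows "flow_payoff P G i = (1 - \<delta>) * link_value i (neighbors G i)"
proof -
  have "neighbors G j = neighbors g j" if "j \<in> neighbors G i" for j
  proof -
    have "j \<noteq> i" using that neighbors_irrefl[OF net] by auto
    show ?thesis
    proof (intro equalityI subsetI)
      fix k assume k: "k \<in> neighbors g j"
      show "k \<in> neighbors G j"
      proof (cases "k = i")
        case True
        then show ?thesis using that by (simp add: neighbors_sym)
      next
        case False
        then show ?thesis using k assms(3) \<open>j \<noteq> i\<close> by (auto simp: neighbors_def)
      qed
    qed (use assms(2) in \<open>auto simp: neighbors_def\<close>)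
  qed
  then have "deg G j = deg g j" if "j \<in> neighbors G i" for j using that by (simp add: deg_def)
  then have "(\<Sum>j\<in>neighbors G i. \<alpha> * c * (prob_able G j / real (deg G j)))
      = (\<Sum>j\<in>neighbors G i. \<alpha> * c * (prob_able g j / real (deg g j)))"
    by (intro sum.cong) auto
  then show ?thesis using params_simps by (simp add: flow_payoff_def link_value_def deg_def)
qed

lemma bounded_value: "\<exists>K. \<forall>T. \<bar>link_value i T\<bar> \<le> K"
proof (intro exI allI)
  fix T :: "'n set"
  show "\<bar>link_value i T\<bar> \<le> Max (range (\<lambda>T. \<bar>link_value i T\<bar>))" by (rule Max_ge) auto
qed

lemma good_links_snoc:
  "good_links i (h @ [(d, m)]) = {j \<in> neighbors (prune (current_network g h) d) i. clean (h @ [(d, m)]) i j}"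
  by (simp add: good_links_def neighbors_def)

section \<open>Beliefs after vanishing trembles\<close>

text \<open>
  Localizing a history erases everything \<open>i\<close> did not take part in. This does not change what \<open>i\<close>
  observes and undoes every mistake between other players, so it cannot make the history less
  likely by more than a constant factor.
\<close>

definition localize_entry :: "'n \<Rightarrow> 'n decisions \<times> 'n interaction \<Rightarrow> 'n decisions \<times> 'n interaction" where
  "localize_entry i = (\<lambda>(d, m). (\<lambda>(a, b). if a = i \<or> b = i then d (a, b) else Keep, involving i m))"

definition localize :: "'n \<Rightarrow> 'n history \<Rightarrow> 'n history" where
  "localize i h = map (localize_entry i) h"

abbreviation "localize_decisions i d \<equiv> (\<lambda>(a, b). if a = i \<or> b = i then d (a, b) else Keep)"

lemma localize_simps [simp]:
  "localize i [] = []"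
  "localize i (h @ [(d, m)]) = localize i h @ [(localize_decisions i d, involving i m)]"
  "length (localize i h) = length h"
  by (simp_all add: localize_def localize_entry_def)

lemma involving_Some: "involving i (Some (r, q, x)) = (if i = r \<or> i = q then Some (r, q, x) else None)"
  by (simp add: involving_def)

lemma involving_None [simp]: "involving i None = None"
  by (simp add: involving_def)

lemma quiet_localize: "quiet i (localize i h)"
proof (induction h rule: rev_induct)
  case (snoc x h)
  obtain d m where "x = (d, m)" by (cases x)
  moreover have "quiet_decisions i (localize_decisions i d)" by (simp add: quiet_decisions_def)
  moreover have "quiet_interaction i (involving i m)"
    by (cases m) (auto simp: quiet_interaction_def involving_Some split: if_splits)
  ultimately show ?case using snoc by (simp add: quiet_snoc)
qed simp

lemma localize_link: "{i, b} \<in> current_network g (localize i h) \<longleftrightarrow> {i, b} \<in> current_network g h"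
proof (induction h rule: rev_induct)
  case (snoc x h)
  then show ?case by (cases x) (simp add: prune_iff)
qed simp

lemma localize_link':
  "a = i \<or> b = i \<Longrightarrow> {a, b} \<in> current_network g (localize i h) \<longleftrightarrow> {a, b} \<in> current_network g h"
  using localize_link[of i] by (auto simp: insert_commute)

lemma localize_prune_link:
  assumes "a = i \<or> b = i"
  shows "{a, b} \<in> prune (current_network g (localize i h)) (localize_decisions i d)
    \<longleftrightarrow> {a, b} \<in> prune (current_network g h) d"
  using assms localize_link'[OF assms] by (auto simp: prune_iff)

lemma localize_clean: "a = i \<or> b = i \<Longrightarrow> clean (localize i h) a b \<longleftrightarrow> clean h a b"
proof (induction h rule: rev_induct)
  case (snoc x h)
  obtain d m where x: "x = (d, m)" by (cases x)
  have "(\<forall>r q. involving i m = Some (r, q, Refuse) \<longrightarrow> {r, q} \<noteq> {a, b}) \<longleftrightarrow>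
      (\<forall>r q. m = Some (r, q, Refuse) \<longrightarrow> {r, q} \<noteq> {a, b})"
    using snoc.prems by (cases m) (auto simp: involving_Some split: if_splits)
  then show ?case using snoc by (simp only: x localize_simps clean_snoc)
qed simp

lemma localize_trigger:
  assumes "a \<noteq> b" "a = i \<or> b = i"
  shows "trigger \<epsilon> a (private_history g a (localize i h)) b = trigger \<epsilon> a (private_history g a h) b"
  by (simp add: trigger_eq[OF assms(1)] localize_clean[OF assms(2)])

lemma private_history_snoc:
  "private_history g i (h @ [(d, m)]) =
    (fst (private_history g i h) @ [(snd (private_history g i h), \<lambda>j. d (i, j), involving i m)],
     neighbors (prune (current_network g h) d) i)"
  by (auto simp: private_history_def nth_append)

lemma private_history_localize: "private_history g i (localize i h) = private_history g i h"
proof (induction h rule: rev_induct)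
  case (snoc x h)
  obtain d m where x: "x = (d, m)" by (cases x)
  have "involving i (involving i m) = involving i m"
    by (cases m) (auto simp: involving_Some)
  moreover have "neighbors (prune (current_network g (localize i h)) (localize_decisions i d)) i
      = neighbors (prune (current_network g h) d) i"
    using localize_prune_link[of i i] unfolding neighbors_def by simp
  ultimately show ?case using snoc unfolding x localize_simps private_history_snoc by simp
qed simp

text \<open>Decisions are independent, so the likelihood splits into a factor \<open>A\<close> for
  pairs containing \<open>i\<close> and a factor \<open>B\<close> for the others. Localizing
  preserves links and states at \<open>i\<close>, hence \<open>A\<close>; among the others everybody
  now keeps as intended, with probability \<open>1 - \<epsilon> \<ge> 1 / 2\<close> per decision,
  which yields the power of 2. The tremble is charged only when \<open>h\<close> is quiet: after an
  earlier breach a removal between others may be intended.\<close>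

lemma link_decisions_localize:
  assumes eps: "0 \<le> \<epsilon>" "\<epsilon> \<le> 1 / 2"
  shows "pmf (link_decisions g (trigger \<epsilon>) h) d \<le>
    (if quiet i h \<and> \<not> quiet_decisions i d then \<epsilon> else 1) *
    (2 ^ CARD('n \<times> 'n) * pmf (link_decisions g (trigger \<epsilon>) (localize i h)) (localize_decisions i d))"
    (is "_ \<le> ?\<eta> * (2 ^ ?s * pmf (link_decisions g _ ?h') ?d')")
proof -
  let ?L = "\<lambda>h. {(a, b). {a, b} \<in> current_network g h}"
  let ?I = "{(a, b). a = i \<or> b = i}"
  define f where "f h d = (\<lambda>(a, b). pmf (fst (trigger \<epsilon> a (private_history g a h) b)) (d (a, b)))"
    for h :: "'n history" and d :: "'n decisions"
  have f01: "0 \<le> f h d x" "f h d x \<le> 1" for h d x by (auto simp: f_def pmf_le_1 split: prod.split)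
  have eta: "0 \<le> ?\<eta>" using eps by simp
  have pmf_eq: "pmf (link_decisions g (trigger \<epsilon>) h) d =
      (\<Prod>x\<in>?L h \<inter> ?I. f h d x) * (\<Prod>x\<in>?L h - ?I. f h d x)"
    if "\<forall>x. x \<notin> ?L h \<longrightarrow> d x = Keep" for h d
  proof -
    have "pmf (link_decisions g (trigger \<epsilon>) h) d = (\<Prod>x\<in>?L h. f h d x)"
      unfolding link_decisions_def using that
      by (subst pmf_Pi') (auto simp: f_def intro!: prod.cong)
    also have "\<dots> = (\<Prod>x\<in>?L h \<inter> ?I. f h d x) * (\<Prod>x\<in>?L h - ?I. f h d x)"
      by (rule prod.Int_Diff) simp
    finally show ?thesis .
  qed
  have neq: "a \<noteq> b" if "(a, b) \<in> ?L h" for a b h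
    using that network_irrefl[OF network_current, of a b] by auto
  show ?thesis
  proof (cases "\<forall>x. x \<notin> ?L h \<longrightarrow> d x = Keep")
    case False
    then have "pmf (link_decisions g (trigger \<epsilon>) h) d = 0"
      unfolding link_decisions_def by (intro pmf_Pi_outside) auto
    then show ?thesis using eta by simp
  next
    case True
    define A where "A = (\<Prod>x\<in>?L h \<inter> ?I. f h d x)"
    define B where "B = (\<Prod>x\<in>?L h - ?I. f h d x)"
    define B' where "B' = (\<Prod>x\<in>?L ?h' - ?I. f ?h' ?d' x)"
    have "0 \<le> A" unfolding A_def by (intro prod_nonneg ballI f01)
    have A': "(\<Prod>x\<in>?L ?h' \<inter> ?I. f ?h' ?d' x) = A"
      unfolding A_def
    proof (rule prod.cong)
      show "?L ?h' \<inter> ?I = ?L h \<inter> ?I" using localize_link'[of _ i] by auto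
    next
      fix x assume x: "x \<in> ?L h \<inter> ?I"
      obtain a b where ab: "x = (a, b)" by (cases x)
      then show "f ?h' ?d' x = f h d x"
        using x neq[of a b h] localize_trigger[of a b i] by (auto simp: f_def)
    qed
    have "(1 / 2) ^ ?s \<le> B'"
    proof -
      have "(1 / 2 :: real) ^ ?s \<le> (1 / 2) ^ card (?L ?h' - ?I)"
        by (intro power_decreasing card_mono) auto
      also have "\<dots> = (\<Prod>x\<in>?L ?h' - ?I. 1 / 2)" by simp
      also have "\<dots> \<le> B'"
        unfolding B'_def
      proof (rule prod_mono)
        fix x assume x: "x \<in> ?L ?h' - ?I"
        obtain a b where ab: "x = (a, b)" by (cases x)
        then have "a \<noteq> b" "clean ?h' a b"
          using x neq[of a b ?h'] quiet_clean[OF quiet_localize, of a i b h] by auto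
        then have "f ?h' ?d' x = 1 - \<epsilon>"
          using x eps by (simp add: ab f_def trigger_eq pmf_tremble)
        then show "0 \<le> (1 / 2 :: real) \<and> 1 / 2 \<le> f ?h' ?d' x" using eps by simp
      qed
      finally show ?thesis .
    qed
    then have "1 \<le> 2 ^ ?s * B'"
      by (simp add: power_one_over field_simps)
    have "B \<le> ?\<eta>"
    proof (cases "quiet i h \<and> \<not> quiet_decisions i d")
      case True
      then obtain a b where ab: "a \<noteq> i" "b \<noteq> i" "d (a, b) \<noteq> Keep"
        by (auto simp: quiet_decisions_def)
      then have mem: "(a, b) \<in> ?L h - ?I" using \<open>\<forall>x. x \<notin> ?L h \<longrightarrow> d x = Keep\<close> by auto
      have "d (a, b) = Remove" using ab(3) by (cases "d (a, b)") auto
      moreover have "clean h a b" using quiet_clean True ab by blast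
      moreover have "a \<noteq> b" using neq[of a b h] mem by auto
      ultimately have "f h d (a, b) = \<epsilon>"
        using eps by (simp add: f_def trigger_eq pmf_tremble)
      have "B = f h d (a, b) * (\<Prod>x\<in>?L h - ?I - {(a, b)}. f h d x)"
        unfolding B_def using mem by (intro prod.remove) auto
      also have "\<dots> \<le> f h d (a, b) * 1"
        by (intro mult_left_mono prod_le_1 conjI f01)
      finally show ?thesis using True \<open>f h d (a, b) = \<epsilon>\<close> by simp
    next
      case False
      then show ?thesis unfolding B_def by (auto intro!: prod_le_1 f01)
    qed
    have "\<forall>x. x \<notin> ?L ?h' \<longrightarrow> ?d' x = Keep"
      using True localize_link'[of _ i _ h] by auto
    then have "pmf (link_decisions g (trigger \<epsilon>) ?h') ?d' = A * B'"
      using pmf_eq[of ?h' ?d'] A' by (simp only: B'_def)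
    moreover have "pmf (link_decisions g (trigger \<epsilon>) h) d = A * B"
      using pmf_eq[OF True] by (simp only: A_def B_def)
    moreover have "A * B \<le> A * ?\<eta> * 1"
      using \<open>B \<le> ?\<eta>\<close> \<open>0 \<le> A\<close> by (simp only: mult_1_right) (rule mult_left_mono)
    moreover have "A * ?\<eta> * 1 \<le> A * ?\<eta> * (2 ^ ?s * B')"
      using \<open>1 \<le> 2 ^ ?s * B'\<close> \<open>0 \<le> A\<close> eta by (intro mult_left_mono mult_nonneg_nonneg)
    ultimately show ?thesis by (simp only: mult_ac)
  qed
qed

text \<open>There are finitely many networks and matchings, so all positive matching probabilities
  share a positive lower bound that depends neither on the history nor on the tremble.\<close>

definition min_matching :: real where
  "min_matching = Min (insert 1 ((\<lambda>(G, m). pmf (matching P G) m) `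
     {(G :: 'n set set, m). m \<in> set_pmf (matching P G)}))"

lemma min_matching_pos: "0 < min_matching"
  unfolding min_matching_def by (subst Min_gr_iff) (auto simp: pmf_positive)

lemma min_matching_le:
  fixes G :: "'n set set"
  shows "m \<in> set_pmf (matching P G) \<Longrightarrow> min_matching \<le> pmf (matching P G) m"
  unfolding min_matching_def by (intro Min_le) auto

text \<open>The likelihood that localizing can cost in one period: the power of 2 accounts for link
  decisions, the denominator for the matching.\<close>

definition ratio_bound :: real where
  "ratio_bound = 2 ^ CARD('n \<times> 'n) / min_matching"

lemma ratio_bound_pos: "0 < ratio_bound"
  using min_matching_pos by (simp add: ratio_bound_def)

lemma pmf_pre_action:
  "pmf (pre_action P g \<sigma> h) (d, m) =
    pmf (link_decisions g \<sigma> h) d * pmf (matching P (prune (current_network g h) d)) m"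
proof -
  have "pmf (pre_action P g \<sigma> h) (d, m) = pmf (link_decisions g \<sigma> h) d *
      pmf (map_pmf (Pair d) (matching P (prune (current_network g h) d))) (d, m)"
    unfolding pre_action_def by (rule pmf_bind_unique) (auto simp: pmf_eq_0_set_pmf)
  also have "pmf (map_pmf (Pair d) (matching P (prune (current_network g h) d))) (d, m) =
      pmf (matching P (prune (current_network g h) d)) m"
    by (rule pmf_map_inj') (simp add: inj_def)
  finally show ?thesis .
qed

definition involved :: "'n \<Rightarrow> ('n \<times> 'n) option \<Rightarrow> ('n \<times> 'n) option" where
  "involved i m = (case m of None \<Rightarrow> None | Some (r, q) \<Rightarrow> if i = r \<or> i = q then m else None)"

lemma involved_simps [simp]:
  "involved i None = None"
  "involved i (Some (r, q)) = (if i = r \<or> i = q then Some (r, q) else None)"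
  by (simp_all add: involved_def)

text \<open>The localized matching is either on a surviving link of \<open>i\<close> or idle, hence
  possible in the localized network; possible matchings have probability at least
  \<open>min_matching\<close>.\<close>

lemma matching_localize:
  "pmf (matching P (prune (current_network g h) d)) m \<le>
    pmf (matching P (prune (current_network g (localize i h)) (localize_decisions i d))) (involved i m) / min_matching"
proof (cases "m \<in> set_pmf (matching P (prune (current_network g h) d))")
  case True
  have "involved i m \<in> set_pmf (matching P (prune (current_network g (localize i h)) (localize_decisions i d)))"
    using True localize_prune_link[of _ i _ h d]
    unfolding set_pmf_matching[OF network_prune_current] by auto
  then have "min_matching \<le>
      pmf (matching P (prune (current_network g (localize i h)) (localize_decisions i d))) (involved i m)"
    by (rule min_matching_le)
  then have "1 \<le> pmf (matching P (prune (current_network g (localize i h)) (localize_decisions i d))) (involved i m) / min_matching"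
    using min_matching_pos by simp
  then show ?thesis by (rule order_trans[OF pmf_le_1])
next
  case False
  then show ?thesis using min_matching_pos by (simp add: set_pmf_iff)
qed

lemma pre_action_localize:
  assumes eps: "0 \<le> \<epsilon>" "\<epsilon> \<le> 1 / 2"
  shows "pmf (pre_action P g (trigger \<epsilon>) h) (d, m) \<le>
    (if quiet i h \<and> \<not> quiet_decisions i d then \<epsilon> else 1) *
    (ratio_bound * pmf (pre_action P g (trigger \<epsilon>) (localize i h)) (localize_decisions i d, involved i m))"
proof -
  have "pmf (pre_action P g (trigger \<epsilon>) h) (d, m) \<le>
    ((if quiet i h \<and> \<not> quiet_decisions i d then \<epsilon> else 1) *
    (2 ^ CARD('n \<times> 'n) * pmf (link_decisions g (trigger \<epsilon>) (localize i h)) (localize_decisions i d))) *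
    (pmf (matching P (prune (current_network g (localize i h)) (localize_decisions i d))) (involved i m) / min_matching)"
    unfolding pmf_pre_action
    by (rule mult_mono[OF link_decisions_localize[OF eps] matching_localize]) (use eps in auto)
  then show ?thesis unfolding pmf_pre_action ratio_bound_def by (simp add: mult_ac)
qed

lemma pmf_period:
  "pmf (period P g \<sigma> h) (h @ [(d, None)]) = pmf (pre_action P g \<sigma> h) (d, None)"
  "pmf (period P g \<sigma> h) (h @ [(d, Some (r, q, x))]) =
    pmf (pre_action P g \<sigma> h) (d, Some (r, q)) * pmf (snd (\<sigma> q (private_history g q h) r)) x"
proof -
  let ?f = "\<lambda>(d, m). case m of None \<Rightarrow> return_pmf (h @ [(d, None)])
    | Some (r, q) \<Rightarrow> map_pmf (\<lambda>a. h @ [(d, Some (r, q, a))]) (snd (\<sigma> q (private_history g q h) r))"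
  have "pmf (period P g \<sigma> h) (h @ [(d, None)]) =
      pmf (pre_action P g \<sigma> h) (d, None) * pmf (?f (d, None)) (h @ [(d, None)])"
    unfolding period_def by (rule pmf_bind_unique) (auto simp: pmf_eq_0_set_pmf split: option.splits)
  then show "pmf (period P g \<sigma> h) (h @ [(d, None)]) = pmf (pre_action P g \<sigma> h) (d, None)" by simp
  have "pmf (period P g \<sigma> h) (h @ [(d, Some (r, q, x))]) =
      pmf (pre_action P g \<sigma> h) (d, Some (r, q)) * pmf (?f (d, Some (r, q))) (h @ [(d, Some (r, q, x))])"
    unfolding period_def by (rule pmf_bind_unique) (auto simp: pmf_eq_0_set_pmf split: option.splits)
  also have "pmf (?f (d, Some (r, q))) (h @ [(d, Some (r, q, x))]) = pmf (snd (\<sigma> q (private_history g q h) r)) x"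
    using pmf_map_inj'[of "\<lambda>a. h @ [(d, Some (r, q, a))]"] by (simp add: inj_def)
  finally show "pmf (period P g \<sigma> h) (h @ [(d, Some (r, q, x))]) =
    pmf (pre_action P g \<sigma> h) (d, Some (r, q)) * pmf (snd (\<sigma> q (private_history g q h) r)) x" .
qed

text \<open>An interaction of \<open>i\<close> has the same action probability in both histories.
  One between others is erased, so its action probability is simply lost: at most 1, and
  \<open>\<epsilon>\<close> if it is the first breach. If the first breach is a removal, the tremble
  comes from the link decisions instead.\<close>

lemma period_localize:
  assumes eps: "0 \<le> \<epsilon>" "\<epsilon> \<le> 1 / 2"
  shows "pmf (period P g (trigger \<epsilon>) h) (h @ [(d, m)]) \<le>
    (if quiet i h \<and> \<not> quiet i (h @ [(d, m)]) then \<epsilon> else 1) *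
    (ratio_bound * pmf (period P g (trigger \<epsilon>) (localize i h)) (localize i (h @ [(d, m)])))"
proof (cases m)
  case None
  have "quiet_interaction i None" by (simp add: quiet_interaction_def)
  then show ?thesis
    using pre_action_localize[OF eps, of h d None i] None
    by (cases "quiet i h"; cases "quiet_decisions i d") (simp_all add: pmf_period quiet_snoc)
next
  case (Some y)
  obtain r q x where y: "y = (r, q, x)" by (cases y)
  let ?pa = "pmf (pre_action P g (trigger \<epsilon>) h) (d, Some (r, q))"
  let ?pa' = "pmf (pre_action P g (trigger \<epsilon>) (localize i h)) (localize_decisions i d, involved i (Some (r, q)))"
  let ?act = "pmf (snd (trigger \<epsilon> q (private_history g q h) r)) x"
  have lhs: "pmf (period P g (trigger \<epsilon>) h) (h @ [(d, m)]) = ?pa * ?act"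
    by (simp add: Some y pmf_period)
  have pa: "?pa \<le> (if quiet i h \<and> \<not> quiet_decisions i d then \<epsilon> else 1) * (ratio_bound * ?pa')"
    by (rule pre_action_localize[OF eps])
  have nonneg: "0 \<le> ratio_bound * ?pa'" using ratio_bound_pos by simp
  show ?thesis
  \<comment> \<open>A positive probability makes \<open>{r, q}\<close> a link and thus gives
    \<open>r \<noteq> q\<close>, on which the form of the trigger strategies depends.\<close>
  proof (cases "?pa = 0")
    case True
    then show ?thesis using eps ratio_bound_pos by (simp add: lhs)
  next
    case False
    then have "pmf (matching P (prune (current_network g h) d)) (Some (r, q)) \<noteq> 0"
      unfolding pmf_pre_action by simp
    then have "{r, q} \<in> prune (current_network g h) d"
      using set_pmf_matching[OF network_prune_current] by (auto simp: set_pmf_iff[symmetric])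
    then have "r \<noteq> q" by (rule network_irrefl_prune)
    show ?thesis
    proof (cases "i = r \<or> i = q")
      case True
      then have "trigger \<epsilon> q (private_history g q (localize i h)) r = trigger \<epsilon> q (private_history g q h) r"
        using \<open>r \<noteq> q\<close> by (intro localize_trigger) auto
      then have rhs: "pmf (period P g (trigger \<epsilon>) (localize i h)) (localize i (h @ [(d, m)])) = ?pa' * ?act"
        using True by (simp add: Some y pmf_period involving_Some)
      have "quiet_interaction i m" using True by (auto simp: Some y quiet_interaction_def)
      then have "?pa * ?act \<le> (if quiet i h \<and> \<not> quiet i (h @ [(d, m)]) then \<epsilon> else 1) * (ratio_bound * ?pa') * ?act"
        using pa by (intro mult_right_mono) (auto simp: quiet_snoc)
      then show ?thesis unfolding lhs rhs by (simp only: mult_ac)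
    next
      case out: False
      then have rhs: "pmf (period P g (trigger \<epsilon>) (localize i h)) (localize i (h @ [(d, m)])) = ?pa'"
        by (simp add: Some y pmf_period involving_Some)
      show ?thesis
      proof (cases "quiet i h \<and> quiet_decisions i d \<and> x = Refuse")
        case True
        \<comment> \<open>Nothing has gone wrong between others before this refusal, so it is an
          error and has probability exactly \<open>\<epsilon>\<close>.\<close>
        then have "clean h q r" using quiet_clean out by auto
        then have "?act = \<epsilon>" using True \<open>r \<noteq> q\<close> eps by (simp add: trigger_eq pmf_tremble)
        moreover have "\<not> quiet i (h @ [(d, m)])"
          using out True by (auto simp: Some y quiet_snoc quiet_interaction_def)
        moreover have "?pa * \<epsilon> \<le> ratio_bound * ?pa' * \<epsilon>"
          using pa True eps by (intro mult_right_mono) auto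
        ultimately show ?thesis unfolding lhs rhs using True by (simp add: mult_ac)
      next
        case False
        have "?pa * ?act \<le> ?pa * 1" by (intro mult_left_mono pmf_le_1) simp
        also have "\<dots> \<le> (if quiet i h \<and> \<not> quiet i (h @ [(d, m)]) then \<epsilon> else 1) * (ratio_bound * ?pa')"
        proof -
          have "quiet i h \<Longrightarrow> quiet i (h @ [(d, m)]) \<longleftrightarrow> quiet_decisions i d"
            using False by (auto simp: Some y quiet_snoc quiet_interaction_def)
          then have "(if quiet i h \<and> \<not> quiet i (h @ [(d, m)]) then \<epsilon> else 1) =
              (if quiet i h \<and> \<not> quiet_decisions i d then \<epsilon> else 1)" by auto
          then show ?thesis using pa by (simp only: mult_1_right)
        qed
        finally show ?thesis unfolding lhs rhs .
      qed
    qed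
  qed
qed

lemma pmf_play_snoc:
  "pmf (play P g \<sigma> [] (Suc n)) (h @ [e]) = pmf (play P g \<sigma> [] n) h * pmf (period P g \<sigma> h) (h @ [e])"
  unfolding play.simps by (rule pmf_bind_unique) (auto simp: pmf_eq_0_set_pmf set_period)

text \<open>The factor \<open>\<epsilon>\<close> is collected exactly once, in the period in which
  the history stops being quiet; one mistake among others is enough for the posterior to
  vanish.\<close>

lemma play_localize:
  assumes eps: "0 \<le> \<epsilon>" "\<epsilon> \<le> 1 / 2"
  shows "pmf (play P g (trigger \<epsilon>) [] (length h)) h \<le>
    (if quiet i h then 1 else \<epsilon>) *
    (ratio_bound ^ length h * pmf (play P g (trigger \<epsilon>) [] (length h)) (localize i h))"
proof (induction h rule: rev_induct)
  case (snoc e h)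
  obtain d m where e: "e = (d, m)" by (cases e)
  let ?play = "\<lambda>h. pmf (play P g (trigger \<epsilon>) [] (length h))"
  let ?h = "h @ [(d, m)]"
  define A where "A = (if quiet i h then 1 else \<epsilon>)"
  define B where "B = (if quiet i h \<and> \<not> quiet i ?h then \<epsilon> else 1)"
  have AB: "A * B = (if quiet i ?h then 1 else \<epsilon>)"
    by (auto simp: A_def B_def quiet_snoc)
  have "?play ?h ?h = ?play h h * pmf (period P g (trigger \<epsilon>) h) ?h"
    by (simp add: pmf_play_snoc del: play.simps)
  also have "\<dots> \<le> (A * (ratio_bound ^ length h * ?play h (localize i h))) *
      (B * (ratio_bound * pmf (period P g (trigger \<epsilon>) (localize i h)) (localize i ?h)))"
    unfolding A_def B_def
    by (rule mult_mono[OF snoc period_localize[OF eps]]) (use eps ratio_bound_pos in auto)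
  also have "\<dots> = A * B * (ratio_bound ^ length ?h * ?play ?h (localize i ?h))"
    by (simp add: pmf_play_snoc mult_ac del: play.simps)
  finally show ?case unfolding AB e .
qed simp

section \<open>Bayesian beliefs along the trembles\<close>

lemma trigger_full_support:
  assumes "0 < \<epsilon>" "\<epsilon> < 1" "a \<noteq> b"
  shows "set_pmf (fst (trigger \<epsilon> a (private_history g a h) b)) = UNIV"
    "set_pmf (snd (trigger \<epsilon> a (private_history g a h) b)) = UNIV"
  using assms by (auto simp: trigger_eq set_pmf_tremble UNIV_link_choice UNIV_action)

lemma totally_mixed_trigger: "0 < \<epsilon> \<Longrightarrow> \<epsilon> < 1 \<Longrightarrow> totally_mixed P g (trigger \<epsilon>)"
  by (simp add: totally_mixed_def trigger_full_support)

lemma feasible_in_link_decisions: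
  assumes "0 < \<epsilon>" "\<epsilon> < 1" "feasible_decisions g h d"
  shows "d \<in> set_pmf (link_decisions g (trigger \<epsilon>) h)"
  unfolding set_link_decisions
proof (intro allI)
  fix a b
  show "if {a, b} \<in> current_network g h
      then d (a, b) \<in> set_pmf (fst (trigger \<epsilon> a (private_history g a h) b)) else d (a, b) = Keep"
  proof (cases "{a, b} \<in> current_network g h")
    case True
    then have "a \<noteq> b" by (rule network_irrefl[OF network_current])
    then show ?thesis using True assms by (simp add: trigger_full_support)
  qed (use assms(3) in \<open>simp add: feasible_decisions_def\<close>)
qed

lemma histories_in_play:
  assumes "0 < \<epsilon>" "\<epsilon> < 1" "h \<in> histories P g"
  shows "h \<in> set_pmf (play P g (trigger \<epsilon>) [] (length h))"
  using assms(3)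
proof (induction rule: histories.induct)
  case (no_favor h d)
  then have "h @ [(d, None)] \<in> set_pmf (period P g (trigger \<epsilon>) h)"
    using feasible_in_link_decisions[OF assms(1,2)] by (auto simp: set_period)
  then show ?case using no_favor by auto
next
  case (favor h d r q a)
  then have rq: "{r, q} \<in> prune (current_network g h) d"
    by (auto simp: set_pmf_matching[OF network_prune_current])
  then have "q \<noteq> r" using network_irrefl_prune by blast
  then have "h @ [(d, Some (r, q, a))] \<in> set_pmf (period P g (trigger \<epsilon>) h)"
    using feasible_in_link_decisions[OF assms(1,2) favor(2)] rq assms
    by (auto simp: set_period trigger_full_support)
  then show ?case using favor by auto
qed simp

lemma profile_converges_trigger:
  assumes "\<And>k. 0 \<le> e k" "\<And>k. e k \<le> 1" "e \<longlonglongrightarrow> 0"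
  shows "profile_converges P g (\<lambda>k. trigger (e k)) (trigger 0)"
proof -
  note conv = tremble_converges[OF _ _ assms]
  have U: "UNIV = {Remove, Keep}" "UNIV = {Refuse, Provide}"
    using UNIV_link_choice UNIV_action by auto
  show ?thesis unfolding profile_converges_def
  proof (intro allI ballI impI conjI)
    fix i j :: 'n and h assume "i \<noteq> j"
    show "pmf_converges (\<lambda>k. fst (trigger (e k) i (private_history g i h) j))
        (fst (trigger 0 i (private_history g i h) j))"
      by (cases "clean h i j")
         (auto simp: trigger_eq[OF \<open>i \<noteq> j\<close>] simp del: tremble_0 intro!: conv UNIV_link_choice U)
    show "pmf_converges (\<lambda>k. snd (trigger (e k) i (private_history g i h) j))
        (snd (trigger 0 i (private_history g i h) j))"
      by (cases "clean h i j")
         (auto simp: trigger_eq[OF \<open>i \<noteq> j\<close>] simp del: tremble_0 intro!: conv UNIV_action U)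
  qed
qed

lemma finite_histories_length: "finite {h :: 'n history. length h = n}"
  using finite_lists_length_eq[of "UNIV :: ('n decisions \<times> 'n interaction) set" n] by simp

lemma bayes_link_nonempty:
  assumes "0 < \<epsilon>" "\<epsilon> < 1" "h \<in> histories P g"
  shows "set_pmf (play P g (trigger \<epsilon>) [] (length (fst (private_history g i h)))) \<inter>
    {h'. private_history g i h' = private_history g i h} \<noteq> {}"
  using histories_in_play[OF assms] by auto

lemma bayes_link_support:
  assumes "0 < \<epsilon>" "\<epsilon> < 1" "h \<in> histories P g"
  shows "set_pmf (bayes_link P g (trigger \<epsilon>) i (private_history g i h)) \<subseteq> {h'. length h' = length h}"
  unfolding bayes_link_def set_cond_pmf[OF bayes_link_nonempty[OF assms]]
  by (auto dest: length_play)

text \<open>The localized history lies in the same information set, so its likelihood may serve as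
  the competitor. The remaining constant depends on the length of the history, which is fixed while
  \<open>\<epsilon>\<close> tends to 0.\<close>

lemma bayes_link_le:
  assumes eps: "0 < \<epsilon>" "\<epsilon> \<le> 1 / 2" and h: "h \<in> histories P g" and "\<not> quiet i x"
  shows "pmf (bayes_link P g (trigger \<epsilon>) i (private_history g i h)) x \<le> \<epsilon> * ratio_bound ^ length h"
proof (cases "private_history g i x = private_history g i h")
  case True
  then have len: "length x = length h" by (metis length_private_history)
  show ?thesis unfolding bayes_link_def
  proof (rule pmf_cond_le[where x' = "localize i x"])
    show "localize i x \<in> {h'. private_history g i h' = private_history g i h}"
      using True by (simp add: private_history_localize)
    show "pmf (play P g (trigger \<epsilon>) [] (length (fst (private_history g i h)))) x \<le>
        \<epsilon> * ratio_bound ^ length h *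
          pmf (play P g (trigger \<epsilon>) [] (length (fst (private_history g i h)))) (localize i x)"
      using play_localize[of \<epsilon> x i] eps assms(4) by (simp add: len mult_ac)
    show "0 \<le> \<epsilon> * ratio_bound ^ length h" using eps ratio_bound_pos by simp
  qed (rule bayes_link_nonempty, use eps h in auto)
next
  case False
  then have "x \<notin> set_pmf (bayes_link P g (trigger \<epsilon>) i (private_history g i h))"
    unfolding bayes_link_def
    by (subst set_cond_pmf[OF bayes_link_nonempty]) (use eps h in auto)
  then show ?thesis using eps ratio_bound_pos by (simp add: set_pmf_iff)
qed

text \<open>The joint law before the projection in \<open>bayes_action\<close>: the matching must
  still be visible when conditioning on being selected.\<close>

definition node_pmf :: "real \<Rightarrow> nat \<Rightarrow> ('n history \<times> 'n decisions \<times> ('n \<times> 'n) option) pmf" where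
  "node_pmf \<epsilon> n = bind_pmf (play P g (trigger \<epsilon>) [] n) (\<lambda>h. map_pmf (Pair h) (pre_action P g (trigger \<epsilon>) h))"

definition information_set :: "'n \<Rightarrow> 'n \<Rightarrow> 'n history \<Rightarrow> 'n decisions \<Rightarrow> ('n history \<times> 'n decisions \<times> ('n \<times> 'n) option) set" where
  "information_set i r h d = {(h', d', m). private_history g i h' = private_history g i h \<and>
     (\<lambda>j. d' (i, j)) = (\<lambda>j. d (i, j)) \<and> m = Some (r, i)}"

lemma bayes_action_eq:
  "bayes_action P g (trigger \<epsilon>) i (private_history g i h) (\<lambda>j. d (i, j)) r =
    map_pmf (\<lambda>(h, d, m). (h, d)) (cond_pmf (node_pmf \<epsilon> (length h)) (information_set i r h d))"
  by (simp add: bayes_action_def node_pmf_def information_set_def)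

lemma pmf_node_pmf: "pmf (node_pmf \<epsilon> n) (h, d, m) =
    pmf (play P g (trigger \<epsilon>) [] n) h * pmf (pre_action P g (trigger \<epsilon>) h) (d, m)"
proof -
  have "pmf (node_pmf \<epsilon> n) (h, d, m) = pmf (play P g (trigger \<epsilon>) [] n) h *
      pmf (map_pmf (Pair h) (pre_action P g (trigger \<epsilon>) h)) (h, d, m)"
    unfolding node_pmf_def by (rule pmf_bind_unique) (auto simp: pmf_eq_0_set_pmf)
  also have "pmf (map_pmf (Pair h) (pre_action P g (trigger \<epsilon>) h)) (h, d, m) =
      pmf (pre_action P g (trigger \<epsilon>) h) (d, m)"
    by (rule pmf_map_inj') (simp add: inj_def)
  finally show ?thesis .
qed

lemma node_pmf_nonempty:
  assumes "0 < \<epsilon>" "\<epsilon> < 1" "(h, d) \<in> action_nodes P g i r"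
  shows "set_pmf (node_pmf \<epsilon> (length h)) \<inter> information_set i r h d \<noteq> {}"
proof -
  have h: "h \<in> histories P g" "feasible_decisions g h d"
    "Some (r, i) \<in> set_pmf (matching P (prune (current_network g h) d))"
    using assms(3) by (auto simp: action_nodes_def)
  have "(h, d, Some (r, i)) \<in> set_pmf (node_pmf \<epsilon> (length h))"
    using histories_in_play[OF assms(1,2) h(1)] feasible_in_link_decisions[OF assms(1,2) h(2)] h(3)
    unfolding set_pmf_iff pmf_node_pmf pmf_pre_action by simp
  then show ?thesis by (auto simp: information_set_def)
qed

text \<open>Inside the information set the matching is known to be \<open>Some (r, i)\<close>, so
  forgetting it merges no outcomes.\<close>

lemma pmf_bayes_action:
  assumes "0 < \<epsilon>" "\<epsilon> < 1" "(h, d) \<in> action_nodes P g i r"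
  shows "pmf (bayes_action P g (trigger \<epsilon>) i (private_history g i h) (\<lambda>j. d (i, j)) r) (x, d') =
    pmf (cond_pmf (node_pmf \<epsilon> (length h)) (information_set i r h d)) (x, d', Some (r, i))"
  unfolding bayes_action_eq
proof (rule pmf_map_unique)
  fix z assume "z \<in> set_pmf (cond_pmf (node_pmf \<epsilon> (length h)) (information_set i r h d))"
  then have "z \<in> information_set i r h d"
    by (simp add: set_cond_pmf[OF node_pmf_nonempty[OF assms]])
  moreover assume "(\<lambda>(h, d, m). (h, d)) z = (x, d')"
  ultimately show "z = (x, d', Some (r, i))" by (auto simp: information_set_def split: prod.splits)
qed simp

lemma bayes_action_support:
  assumes "0 < \<epsilon>" "\<epsilon> < 1" "(h, d) \<in> action_nodes P g i r"
  shows "set_pmf (bayes_action P g (trigger \<epsilon>) i (private_history g i h) (\<lambda>j. d (i, j)) r) \<subseteq>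
    {(x, d'). length x = length h \<and> {r, i} \<in> prune (current_network g x) d'}"
proof clarify
  fix x d' assume "(x, d') \<in> set_pmf (bayes_action P g (trigger \<epsilon>) i (private_history g i h) (\<lambda>j. d (i, j)) r)"
  then have "(x, d', Some (r, i)) \<in> set_pmf (cond_pmf (node_pmf \<epsilon> (length h)) (information_set i r h d))"
    unfolding set_pmf_iff pmf_bayes_action[OF assms] by simp
  then have "(x, d', Some (r, i)) \<in> set_pmf (node_pmf \<epsilon> (length h))"
    by (simp add: set_cond_pmf[OF node_pmf_nonempty[OF assms]])
  then have "x \<in> set_pmf (play P g (trigger \<epsilon>) [] (length h))"
    "Some (r, i) \<in> set_pmf (matching P (prune (current_network g x) d'))"
    unfolding set_pmf_iff pmf_node_pmf pmf_pre_action by auto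
  then show "length x = length h \<and> {r, i} \<in> prune (current_network g x) d'"
    by (auto simp: set_pmf_matching[OF network_prune_current] dest: length_play)
qed

text \<open>The comparison of \<open>bayes_link_le\<close> extended by the decisions and the
  matching of the current period, whence the exponent \<open>Suc (length h)\<close>.\<close>

lemma bayes_action_le:
  assumes eps: "0 < \<epsilon>" "\<epsilon> \<le> 1 / 2" and hd: "(h, d) \<in> action_nodes P g i r"
    and noisy: "\<not> (quiet i x \<and> quiet_decisions i d')"
  shows "pmf (bayes_action P g (trigger \<epsilon>) i (private_history g i h) (\<lambda>j. d (i, j)) r) (x, d')
    \<le> \<epsilon> * ratio_bound ^ Suc (length h)"
proof -
  have eps': "\<epsilon> < 1" "0 \<le> \<epsilon>" using eps by auto
  note nonempty = node_pmf_nonempty[OF eps(1) eps'(1) hd]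
  show ?thesis
  proof (cases "(x, d', Some (r, i)) \<in> information_set i r h d")
    case True
    then have I: "private_history g i x = private_history g i h" "(\<lambda>j. d' (i, j)) = (\<lambda>j. d (i, j))"
      by (auto simp: information_set_def)
    then have len: "length x = length h" by (metis length_private_history)
    show ?thesis unfolding pmf_bayes_action[OF eps(1) eps'(1) hd]
    proof (rule pmf_cond_le[where x' = "(localize i x, localize_decisions i d', Some (r, i))"])
      show "(localize i x, localize_decisions i d', Some (r, i)) \<in> information_set i r h d"
        using I by (simp add: information_set_def private_history_localize)
      let ?A = "if quiet i x then 1 else \<epsilon>" and ?B = "if quiet i x \<and> \<not> quiet_decisions i d' then \<epsilon> else 1"
      have "pmf (node_pmf \<epsilon> (length h)) (x, d', Some (r, i)) \<le>
        (?A * (ratio_bound ^ length x * pmf (play P g (trigger \<epsilon>) [] (length x)) (localize i x))) *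
        (?B * (ratio_bound * pmf (pre_action P g (trigger \<epsilon>) (localize i x))
          (localize_decisions i d', involved i (Some (r, i)))))"
        unfolding pmf_node_pmf len[symmetric]
        by (rule mult_mono[OF play_localize pre_action_localize]) (use eps' eps ratio_bound_pos in auto)
      also have "\<dots> = (?A * ?B) * ratio_bound ^ Suc (length h) *
          pmf (node_pmf \<epsilon> (length h)) (localize i x, localize_decisions i d', Some (r, i))"
        unfolding pmf_node_pmf by (simp add: len mult_ac)
      also have "?A * ?B = \<epsilon>" using noisy by auto
      finally show "pmf (node_pmf \<epsilon> (length h)) (x, d', Some (r, i)) \<le> \<epsilon> * ratio_bound ^ Suc (length h) *
          pmf (node_pmf \<epsilon> (length h)) (localize i x, localize_decisions i d', Some (r, i))" .
      show "0 \<le> \<epsilon> * ratio_bound ^ Suc (length h)" using eps ratio_bound_pos by simp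
    qed (rule nonempty)
  next
    case False
    then have "pmf (cond_pmf (node_pmf \<epsilon> (length h)) (information_set i r h d)) (x, d', Some (r, i)) = 0"
      by (simp add: pmf_cond[OF nonempty])
    then show ?thesis using eps ratio_bound_pos by (simp add: pmf_bayes_action[OF eps(1) eps'(1) hd])
  qed
qed

text \<open>
  The Bayesian beliefs along the trembles lie in a countable product of compact intervals, hence
  converge along a subsequence.
\<close>

lemma beliefs_exist:
  obtains \<mu> \<nu> where "consistent P g (trigger 0) \<mu> \<nu>"
    and "\<forall>i. \<forall>h\<in>histories P g. \<forall>x\<in>set_pmf (\<mu> i (private_history g i h)).
      length x = length h \<and> quiet i x"
    and "\<forall>i r. \<forall>(h, d)\<in>action_nodes P g i r.
      \<forall>(x, d')\<in>set_pmf (\<nu> i (private_history g i h) (\<lambda>j. d (i, j)) r).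
      length x = length h \<and> quiet i x \<and> quiet_decisions i d' \<and> {r, i} \<in> prune (current_network g x) d'"
proof -
  \<comment> \<open>The shift by 2 keeps the trembles at most \<open>1 / 2\<close>, as the
    likelihood bounds require, and below 1, as full support requires.\<close>
  define e0 :: "nat \<Rightarrow> real" where "e0 k = 1 / (real k + 2)" for k
  \<comment> \<open>Both kinds of beliefs are packed into one family, so that a single subsequence
    works for all of them.\<close>
  define f where "f k x = (case x of
      Inl (i, I, h) \<Rightarrow> pmf (bayes_link P g (trigger (e0 k)) i I) h
    | Inr (i, I, e, r, y) \<Rightarrow> pmf (bayes_action P g (trigger (e0 k)) i I e r) y)"
    for k and x :: "('n \<times> 'n private_history \<times> 'n history) +
      ('n \<times> 'n private_history \<times> ('n \<Rightarrow> link_choice) \<times> 'n \<times> ('n history \<times> 'n decisions))"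
  have "norm (f k x) \<le> 1" for k x by (auto simp: f_def pmf_le_1 split: sum.splits)
  then obtain \<kappa> :: "nat \<Rightarrow> nat" where \<kappa>: "strict_mono \<kappa>"
    and lim: "\<And>x. x \<in> UNIV \<Longrightarrow> \<exists>l. (\<lambda>k. f (\<kappa> k) x) \<longlonglongrightarrow> l"
    using function_convergent_subsequence[of UNIV f 1] by (metis UNIV_I uncountable_def countableI_type)
  define e where "e k = e0 (\<kappa> k)" for k
  define s where "s k = trigger (e k)" for k
  have e_pos: "0 < e k" and e_half: "e k \<le> 1 / 2" and e1: "e k < 1" for k
    by (auto simp: e_def e0_def field_simps)
  have "e0 \<longlonglongrightarrow> 0" unfolding e0_def by real_asymp
  then have e_lim: "e \<longlonglongrightarrow> 0"
    unfolding e_def[abs_def] using LIMSEQ_subseq_LIMSEQ[OF _ \<kappa>] by (simp add: o_def)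
  have link_conv: "convergent (\<lambda>k. pmf (bayes_link P g (s k) i I) h)" for i I h
    using lim[of "Inl (i, I, h)"] by (simp add: f_def s_def e_def convergent_def)
  have action_conv: "convergent (\<lambda>k. pmf (bayes_action P g (s k) i I d r) x)" for i I d r x
    using lim[of "Inr (i, I, d, r, x)"] by (simp add: f_def s_def e_def convergent_def)
  \<comment> \<open>Convergence to a distribution is established at information sets of feasible
    histories; elsewhere the choice may be arbitrary, as consistency makes no demand there.\<close>
  define \<mu> where "\<mu> i I = (SOME M. pmf_converges (\<lambda>k. bayes_link P g (s k) i I) M)" for i I
  define \<nu> where "\<nu> i I d r = (SOME M. pmf_converges (\<lambda>k. bayes_action P g (s k) i I d r) M)" for i I d r
  have \<mu>: "pmf_converges (\<lambda>k. bayes_link P g (s k) i (private_history g i h)) (\<mu> i (private_history g i h))"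
    if h: "h \<in> histories P g" for i h
    unfolding \<mu>_def
  proof (rule someI_ex, rule pmf_converges_exists)
    show "finite {x :: 'n history. length x = length h}" by (rule finite_histories_length)
    show "set_pmf (bayes_link P g (s k) i (private_history g i h)) \<subseteq> {x. length x = length h}" for k
      unfolding s_def by (rule bayes_link_support) (use e_pos e1 h in auto)
  qed (rule link_conv)
  have \<nu>: "pmf_converges (\<lambda>k. bayes_action P g (s k) i (private_history g i h) (\<lambda>j. d (i, j)) r)
      (\<nu> i (private_history g i h) (\<lambda>j. d (i, j)) r)"
    if hd: "(h, d) \<in> action_nodes P g i r" for i r h d
    unfolding \<nu>_def
  proof (rule someI_ex, rule pmf_converges_exists)
    show "finite ({x :: 'n history. length x = length h} \<times> (UNIV :: 'n decisions set))"
      using finite_histories_length by simp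
    show "set_pmf (bayes_action P g (s k) i (private_history g i h) (\<lambda>j. d (i, j)) r)
        \<subseteq> {x. length x = length h} \<times> UNIV" for k
      unfolding s_def using bayes_action_support[OF e_pos e1 hd] by fast
  qed (rule action_conv)
  have small: "(\<lambda>k. e k * K) \<longlonglongrightarrow> 0" for K
    using tendsto_mult_right[OF e_lim, of K] by simp
  show thesis
  proof
    have "totally_mixed P g (s k)" for k
      unfolding s_def by (rule totally_mixed_trigger) (use e_pos e1 in auto)
    moreover have "profile_converges P g s (trigger 0)"
      unfolding s_def by (rule profile_converges_trigger) (use e_pos e1 e_lim in \<open>auto simp: less_imp_le\<close>)
    ultimately show "consistent P g (trigger 0) \<mu> \<nu>"
      unfolding consistent_def Let_def using \<mu> \<nu> by blast
  next
    show "\<forall>i. \<forall>h\<in>histories P g. \<forall>x\<in>set_pmf (\<mu> i (private_history g i h)). length x = length h \<and> quiet i x"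
    proof (intro allI ballI)
      fix i h x assume h: "h \<in> histories P g" and x: "x \<in> set_pmf (\<mu> i (private_history g i h))"
      have "length x = length h"
      proof (rule ccontr)
        assume "length x \<noteq> length h"
        then have "pmf (bayes_link P g (s k) i (private_history g i h)) x \<le> 0" for k
          using bayes_link_support[OF e_pos e1 h, of k i] by (auto simp: s_def set_pmf_iff)
        then show False using pmf_converges_support[OF \<mu>[OF h], where x = x and b = "\<lambda>_. 0"] x by auto
      qed
      moreover have "quiet i x"
      proof (rule ccontr)
        assume "\<not> quiet i x"
        then show False
          using pmf_converges_support[OF \<mu>[OF h] _ small] bayes_link_le[OF e_pos e_half h] x
          unfolding s_def by blast
      qed
      ultimately show "length x = length h \<and> quiet i x" ..
    qed
  next
    show "\<forall>i r. \<forall>(h, d)\<in>action_nodes P g i r.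
      \<forall>(x, d')\<in>set_pmf (\<nu> i (private_history g i h) (\<lambda>j. d (i, j)) r).
      length x = length h \<and> quiet i x \<and> quiet_decisions i d' \<and> {r, i} \<in> prune (current_network g x) d'"
    proof clarify
      fix i r h d x d' assume hd: "(h, d) \<in> action_nodes P g i r"
        and x: "(x, d') \<in> set_pmf (\<nu> i (private_history g i h) (\<lambda>j. d (i, j)) r)"
      have "length x = length h \<and> {r, i} \<in> prune (current_network g x) d'"
      proof (rule ccontr)
        assume "\<not> (length x = length h \<and> {r, i} \<in> prune (current_network g x) d')"
        then have "pmf (bayes_action P g (s k) i (private_history g i h) (\<lambda>j. d (i, j)) r) (x, d') \<le> 0" for k
          using bayes_action_support[OF e_pos e1 hd, of k] by (auto simp: s_def set_pmf_iff)
        then show False using pmf_converges_support[OF \<nu>[OF hd], where x = "(x, d')" and b = "\<lambda>_. 0"] x by auto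
      qed
      moreover have "quiet i x \<and> quiet_decisions i d'"
      proof (rule ccontr)
        assume "\<not> (quiet i x \<and> quiet_decisions i d')"
        then show False
          using pmf_converges_support[OF \<nu>[OF hd] _ small] bayes_action_le[OF e_pos e_half hd] x
          unfolding s_def by blast
      qed
      ultimately show "length x = length h \<and> quiet i x \<and> quiet_decisions i d' \<and>
          {r, i} \<in> prune (current_network g x) d'" by blast
    qed
  qed
qed

lemma trigger_on_path:
  assumes "h \<in> set_pmf (play P g (trigger 0) [] n)" "(d, m) \<in> set h"
  shows "(\<forall>a b. d (a, b) = Keep) \<and> (\<forall>r q x. m = Some (r, q, x) \<longrightarrow> x = Provide)"
proof -
  define Inv where "Inv h \<longleftrightarrow> (\<forall>(d, m)\<in>set h. (\<forall>a b. d (a, b) = Keep) \<and>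
    (\<forall>r q x. m = Some (r, q, x) \<longrightarrow> x = Provide))" for h :: "'n history"
  have "Inv h"
  proof (rule play_invariant[where Inv = Inv])
    fix h h' assume inv: "Inv h" and h': "h' \<in> set_pmf (period P g (trigger 0) h)"
    have clean: "clean h a b" for a b using inv by (fastforce simp: Inv_def clean_def)
    have keep: "d (a, b) = Keep" if d: "d \<in> set_pmf (link_decisions g (trigger 0) h)" for d a b
    proof (cases "{a, b} \<in> current_network g h")
      case True
      then have "a \<noteq> b" by (rule network_irrefl[OF network_current])
      then show ?thesis using d[unfolded set_link_decisions, rule_format, of a b] True
        by (simp add: trigger_0_eq clean)
    qed (use d[unfolded set_link_decisions, rule_format, of a b] in simp)
    from h' show "Inv h'"
    proof (cases rule: period_cases)
      case (none d)
      then show ?thesis using inv keep by (auto simp: Inv_def)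
    next
      case (some d r q a)
      then have "q \<noteq> r" using network_irrefl_prune by blast
      then have "a = Provide" using some by (simp add: trigger_0_eq clean)
      then show ?thesis using inv keep some by (auto simp: Inv_def)
    qed
  qed (use assms in \<open>auto simp: Inv_def\<close>)
  then show ?thesis using assms(2) unfolding Inv_def by blast
qed

end

section \<open>Sufficiency\<close>

locale sustainable_network = favor_exchange P g for P :: "'f favor_params" and g :: "'n::finite set set" +
  assumes links_sustainable: "\<forall>e\<in>g. sustainable P g e"
begin

lemma value_gain:
  assumes "T \<subseteq> neighbors g i" "j \<in> T"
  shows "c - \<gamma> \<le> \<delta> * (link_value i T - link_value i (T - {j}))"
proof -
  have j: "j \<in> neighbors g i" "{i, j} \<in> g" using assms by (auto simp: neighbors_def)
  have N: "neighbors (g - {{i, j}}) i = neighbors g i - {j}"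
    by (auto simp: neighbors_def doubleton_eq_iff)
  have "c - \<gamma> \<le> \<delta> / (1 - \<delta>) * flow_payoff P g i - \<delta> / (1 - \<delta>) * flow_payoff P (g - {{i, j}}) i"
    using links_sustainable j(2) by (auto simp: sustainable_def)
  also have "flow_payoff P g i = (1 - \<delta>) * link_value i (neighbors g i)"
    by (rule flow_payoff_quiet) (use network_g in auto)
  \<comment> \<open>Deleting \<open>ij\<close> lowers the degree of \<open>j\<close>, but
    \<open>j\<close> is then no longer a neighbor of \<open>i\<close>; the remaining neighbors keep
    their degrees in \<open>g\<close>.\<close>
  also have "flow_payoff P (g - {{i, j}}) i = (1 - \<delta>) * link_value i (neighbors (g - {{i, j}}) i)"
    by (rule flow_payoff_quiet) (use network_subset[OF network_g] in \<open>auto simp: doubleton_eq_iff\<close>)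
  finally have "c - \<gamma> \<le> \<delta> / (1 - \<delta>) * ((1 - \<delta>) * link_value i (neighbors g i))
      - \<delta> / (1 - \<delta>) * ((1 - \<delta>) * link_value i (neighbors g i - {j}))"
    unfolding N .
  moreover have "\<delta> / (1 - \<delta>) * ((1 - \<delta>) * x) = \<delta> * x" for x
    using params_simps by simp
  ultimately have "c - \<gamma> \<le> \<delta> * (link_value i (neighbors g i) - link_value i (neighbors g i - {j}))"
    by (simp only: right_diff_distrib)
  also have "\<dots> \<le> \<delta> * (link_value i T - link_value i (T - {j}))"
  proof -
    \<comment> \<open>The cost share is common to both sets, so only the probability that
      \<open>j\<close> is the sole able player has to be compared.\<close>
    have "(1 - p) ^ (card (neighbors g i) - 1) \<le> (1 - p) ^ (card T - 1)"
      using params_simps card_mono[OF _ assms(1)] by (intro power_decreasing) auto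
    then have "\<alpha> * v * p * (1 - p) ^ (card (neighbors g i) - 1) \<le> \<alpha> * v * p * (1 - p) ^ (card T - 1)"
      using params_simps by (intro mult_left_mono) auto
    then show ?thesis unfolding value_remove[OF j(1)] value_remove[OF assms(2)]
      using params_simps by (intro mult_left_mono divide_right_mono diff_right_mono) auto
  qed
  finally show ?thesis .
qed

text \<open>A link worth a favor is worth keeping: as \<open>\<gamma> < c\<close>, the bound in
  \<open>value_gain\<close> is strictly positive. Voluntary removals therefore never pay.\<close>

lemma value_remove_le:
  assumes "T \<subseteq> neighbors g i" "j \<in> T"
  shows "link_value i (T - {j}) \<le> link_value i T"
proof -
  have "0 < \<delta> * (link_value i T - link_value i (T - {j}))"
    using value_gain[OF assms] params_simps by linarith
  then show ?thesis using params_simps by (simp add: zero_less_mult_iff)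
qed

lemma value_mono:
  assumes "T \<subseteq> T'" "T' \<subseteq> neighbors g i"
  shows "link_value i T \<le> link_value i T'"
proof -
  have "finite D \<Longrightarrow> T \<union> D \<subseteq> neighbors g i \<Longrightarrow> link_value i T \<le> link_value i (T \<union> D)" for D
  proof (induction D rule: finite_induct)
    case (insert x D)
    show ?case
    proof (cases "x \<in> T \<union> D")
      case True
      then show ?thesis using insert by (simp add: insert_absorb)
    next
      case False
      then have "T \<union> insert x D - {x} = T \<union> D" by auto
      then show ?thesis using insert value_remove_le[of "T \<union> insert x D" i x] by auto
    qed
  qed simp
  from this[of "T'"] show ?thesis using assms by (simp add: Un_absorb1)
qed

text \<open>
  Against trigger strategies \<open>i\<close> faces, after a quiet history, a decision problem whose state is the
  set of her unbroken links; the marginal value of a link decreases in the number of links, so each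
  remains worth a favor when others are gone.
\<close>

context
  fixes i :: 'n and \<tau> :: "'n strategy" and h :: "'n history"
  assumes quiet_h: "quiet i h"
begin

abbreviation "dev \<equiv> (trigger 0)(i := \<tau>)"

abbreviation "payoff_to_go h' \<equiv> period_payoff P i (snd (last h')) + \<delta> * link_value i (good_links i h')"

lemma dev_quiet_decisions:
  assumes "d \<in> set_pmf (link_decisions g dev h)"
  shows "quiet_decisions i d"
  unfolding quiet_decisions_def
proof (intro allI impI)
  fix a b assume ab: "a \<noteq> i" "b \<noteq> i"
  show "d (a, b) = Keep"
  proof (cases "{a, b} \<in> current_network g h")
    case True
    then have "a \<noteq> b" by (rule network_irrefl[OF network_current])
    then have "dev a (private_history g a h) b = (return_pmf Keep, return_pmf Provide)"
      using quiet_clean[OF quiet_h ab] ab by (simp add: trigger_0_eq)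
    then show ?thesis
      using assms[unfolded set_link_decisions, rule_format, of a b] True by simp
  qed (use assms[unfolded set_link_decisions, rule_format, of a b] in simp)
qed

text \<open>The partner has seen the refusal too and removes the link, so no strategy of
  \<open>i\<close> can preserve a broken one.\<close>

lemma dev_surviving_clean:
  assumes d: "d \<in> set_pmf (link_decisions g dev h)" and ij: "{i, j} \<in> prune (current_network g h) d"
  shows "clean h i j"
proof (rule ccontr)
  assume "\<not> clean h i j"
  have *: "{j, i} \<in> current_network g h" "d (j, i) = Keep"
    using ij by (auto simp: prune_iff insert_commute)
  have "j \<noteq> i" using network_irrefl[OF network_current *(1)] .
  then have "dev j (private_history g j h) i = (return_pmf Remove, return_pmf Refuse)"
    using \<open>\<not> clean h i j\<close> by (simp add: trigger_0_eq clean_sym)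
  then show False using d[unfolded set_link_decisions, rule_format, of j i] * by simp
qed

lemma quiet_prune_link:
  assumes "quiet_decisions i d" "{a, b} \<in> g" "a \<noteq> i" "b \<noteq> i"
  shows "{a, b} \<in> prune (current_network g h) d"
  using assms quiet_link[OF quiet_h assms(2)] by (simp add: prune_iff quiet_decisions_def)

lemma flow_payoff_prune:
  assumes "quiet_decisions i d"
  shows "flow_payoff P (prune (current_network g h) d) i =
    (1 - \<delta>) * link_value i (neighbors (prune (current_network g h) d) i)"
  by (rule flow_payoff_quiet[OF network_prune_current])
     (use prune_subset current_network_subset quiet_prune_link[OF assms] in blast)+

lemma neighbors_prune_subset: "neighbors (prune (current_network g h) d) i \<subseteq> neighbors g i"
  using prune_subset current_network_subset by (fastforce simp: neighbors_def)

lemma dev_action: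
  assumes d: "d \<in> set_pmf (link_decisions g dev h)"
    and rq: "{r, q} \<in> prune (current_network g h) d" and "q \<noteq> i"
  shows "snd (dev q (private_history g q h) r) = return_pmf Provide"
proof -
  have "r \<noteq> q" using network_irrefl_prune[OF rq] .
  moreover have "clean h q r"
  proof (cases "r = i")
    case True
    then show ?thesis using dev_surviving_clean[OF d, of q] rq by (simp add: clean_sym)
  next
    case False
    then show ?thesis using quiet_clean[OF quiet_h] assms(3) by auto
  qed
  ultimately show ?thesis using assms(3) by (simp add: trigger_0_eq)
qed

text \<open>Every link of \<open>i\<close> that survives the decisions is unbroken, so the state can
  shrink further within the period only by a refusal of \<open>i\<close> herself.\<close>

lemma good_links_after:
  assumes d: "d \<in> set_pmf (link_decisions g dev h)"
  defines "T \<equiv> neighbors (prune (current_network g h) d) i"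
  shows "good_links i (h @ [(d, None)]) = T"
    and "good_links i (h @ [(d, Some (r, q, Provide))]) = T"
    and "good_links i (h @ [(d, Some (r, i, Refuse))]) = T - {r}"
  using dev_surviving_clean[OF d] unfolding good_links_snoc T_def
  by (auto simp: neighbors_def doubleton_eq_iff)

text \<open>Others provide on surviving links, so the only nodes to check are those where
  \<open>i\<close> is asked: there a refusal saves \<open>c - \<gamma>\<close> and loses the link
  with \<open>r\<close>, which \<open>value_gain\<close> shows to be worth at least as much.\<close>

lemma dev_node_le:
  assumes d: "d \<in> set_pmf (link_decisions g dev h)"
  defines "G \<equiv> prune (current_network g h) d"
  assumes m: "m \<in> set_pmf (matching P G)"
  shows "node_value dev h d payoff_to_go m \<le> full_payoff i m + \<delta> * link_value i (neighbors G i)"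
proof -
  consider "m = None" | r q where "m = Some (r, q)" "{r, q} \<in> G" "q \<noteq> i"
    | r where "m = Some (r, i)" "{r, i} \<in> G"
    using m unfolding G_def set_pmf_matching[OF network_prune_current] by blast
  then show ?thesis
  proof cases
    case 1
    then show ?thesis by (simp add: node_value_def full_payoff_def good_links_after(1)[OF d] G_def)
  next
    case 2
    then show ?thesis using dev_action[OF d, of r q]
      by (simp add: node_value_def full_payoff_def good_links_after(2)[OF d] G_def)
  next
    case 3
    have r: "r \<in> neighbors G i" using 3 by (simp add: neighbors_def insert_commute)
    have "r \<noteq> i" using 3 network_irrefl_prune by (auto simp: G_def)
    have gain: "c - \<gamma> \<le> \<delta> * (link_value i (neighbors G i) - link_value i (neighbors G i - {r}))"
      by (rule value_gain) (use r neighbors_prune_subset in \<open>auto simp: G_def\<close>)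
    have "payoff_to_go (h @ [(d, Some (r, i, x))]) \<le> full_payoff i m + \<delta> * link_value i (neighbors G i)" for x
    proof (cases x)
      case Provide
      then show ?thesis using 3 by (simp add: full_payoff_def good_links_after(2)[OF d] G_def)
    next
      case Refuse
      then show ?thesis using 3 gain \<open>r \<noteq> i\<close>
        by (simp add: full_payoff_def good_links_after(3)[OF d] G_def period_payoff_def algebra_simps)
    qed
    then show ?thesis using 3 by (simp add: node_value_def expectation_le_const)
  qed
qed

lemma value_flow_decomposition:
  assumes "quiet_decisions i d"
  shows "flow_payoff P (prune (current_network g h) d) i
    + \<delta> * link_value i (neighbors (prune (current_network g h) d) i)
    = link_value i (neighbors (prune (current_network g h) d) i)"
  by (simp add: flow_payoff_prune[OF assms] algebra_simps)

text \<open>The Bellman inequality. Whatever \<open>i\<close> decides on her links, what survives is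
  a subset of the good ones, and by monotonicity of the value this cannot raise it.\<close>

lemma dev_step_le:
  "measure_pmf.expectation (period P g dev h) payoff_to_go \<le> link_value i (good_links i h)"
  unfolding expectation_period
proof (rule expectation_le_const)
  fix d assume d: "d \<in> set_pmf (link_decisions g dev h)"
  let ?G = "prune (current_network g h) d"
  have "measure_pmf.expectation (matching P ?G) (node_value dev h d payoff_to_go)
      \<le> measure_pmf.expectation (matching P ?G) (\<lambda>m. full_payoff i m + \<delta> * link_value i (neighbors ?G i))"
    by (intro expectation_mono_finite dev_node_le[OF d]) simp_all
  also have "\<dots> = link_value i (neighbors ?G i)"
    unfolding expectation_full_payoff_add[OF network_prune_current]
    by (rule value_flow_decomposition[OF dev_quiet_decisions[OF d]])
  also have "\<dots> \<le> link_value i (good_links i h)"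
  proof (rule value_mono)
    show "neighbors ?G i \<subseteq> good_links i h"
      using dev_surviving_clean[OF d] by (auto simp: good_links_def neighbors_def prune_iff)
    show "good_links i h \<subseteq> neighbors g i"
      using current_network_subset by (auto simp: good_links_def neighbors_def)
  qed
  finally show "measure_pmf.expectation (matching P ?G) (node_value dev h d payoff_to_go)
      \<le> link_value i (good_links i h)" .
qed simp

text \<open>Quietness constrains only what happens between others, who conform; it is thus an
  invariant under every strategy of \<open>i\<close>.\<close>

lemma dev_quiet_step:
  assumes "h' \<in> set_pmf (period P g dev h)"
  shows "quiet i h'"
  using assms
proof (cases rule: period_cases)
  case (none d)
  then show ?thesis using quiet_h dev_quiet_decisions
    by (auto simp: quiet_snoc quiet_interaction_def)
next
  case (some d r q a)
  then show ?thesis using quiet_h dev_quiet_decisions dev_action[of d r q]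
    by (auto simp: quiet_snoc quiet_interaction_def)
qed

end

lemma trigger_step:
  assumes quiet: "quiet i h"
  shows "measure_pmf.expectation (period P g (trigger 0) h)
      (\<lambda>h'. period_payoff P i (snd (last h')) + \<delta> * link_value i (good_links i h')) = link_value i (good_links i h)"
  unfolding expectation_period
proof (rule expectation_eq_const)
  fix d assume d: "d \<in> set_pmf (link_decisions g (trigger 0) h)"
  let ?G = "prune (current_network g h) d"
  let ?F = "\<lambda>h'. period_payoff P i (snd (last h')) + \<delta> * link_value i (good_links i h')"
  \<comment> \<open>Conforming is the deviation to one's own trigger strategy, so the facts about
    deviations apply.\<close>
  have d': "d \<in> set_pmf (link_decisions g ((trigger 0)(i := trigger 0 i)) h)" using d by simp
  have "neighbors ?G i = good_links i h"
  proof (intro equalityI subsetI)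
    fix j assume "j \<in> good_links i h"
    then have j: "{i, j} \<in> current_network g h" "clean h i j" by (auto simp: good_links_def)
    then have "i \<noteq> j" using network_irrefl[OF network_current] by blast
    then have "d (i, j) = Keep" "d (j, i) = Keep"
      using j d[unfolded set_link_decisions, rule_format, of i j]
        d[unfolded set_link_decisions, rule_format, of j i]
      by (auto simp: trigger_0_eq clean_sym insert_commute)
    then show "j \<in> neighbors ?G i" using j by (simp add: neighbors_def prune_iff)
  qed (use dev_surviving_clean[OF quiet d'] in \<open>auto simp: good_links_def neighbors_def prune_iff\<close>)
  have "measure_pmf.expectation (matching P ?G) (node_value (trigger 0) h d ?F)
      = measure_pmf.expectation (matching P ?G) (\<lambda>m. full_payoff i m + \<delta> * link_value i (neighbors ?G i))"
  proof (rule expectation_cong_pmf)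
    fix m assume "m \<in> set_pmf (matching P ?G)"
    then consider "m = None" | r q where "m = Some (r, q)" "{r, q} \<in> ?G"
      unfolding set_pmf_matching[OF network_prune_current] by blast
    then show "node_value (trigger 0) h d ?F m = full_payoff i m + \<delta> * link_value i (neighbors ?G i)"
    proof cases
      case 1
      then show ?thesis by (simp add: node_value_def full_payoff_def good_links_after(1)[OF quiet d'])
    next
      case 2
      have "q \<noteq> r" using network_irrefl_prune[OF 2(2)] by simp
      have "clean h q r"
      proof (cases "q = i \<or> r = i")
        case True
        then show ?thesis using dev_surviving_clean[OF quiet d', of r] dev_surviving_clean[OF quiet d', of q] 2
          by (auto simp: clean_sym insert_commute)
      qed (use quiet_clean[OF quiet] in auto)
      then show ?thesis using 2 \<open>q \<noteq> r\<close>
        by (simp add: node_value_def full_payoff_def trigger_0_eq good_links_after(2)[OF quiet d'])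
    qed
  qed
  also have "\<dots> = link_value i (neighbors ?G i)"
    unfolding expectation_full_payoff_add[OF network_prune_current]
    by (rule value_flow_decomposition[OF quiet dev_quiet_decisions[OF quiet d']])
  also have "\<dots> = link_value i (good_links i h)" by (simp add: \<open>neighbors ?G i = _\<close>)
  finally show "measure_pmf.expectation (matching P ?G) (node_value (trigger 0) h d ?F) = link_value i (good_links i h)" .
qed

section \<open>Optimality at both kinds of information sets\<close>

lemma trigger_payoff:
  assumes "quiet i h"
  shows "continuation_payoff P g (trigger 0) i h = link_value i (good_links i h)"
proof -
  obtain K where K: "\<And>T. \<bar>link_value i T\<bar> \<le> K" using bounded_value by blast
  show ?thesis
  proof (rule continuation_payoff_eq[where Inv = "quiet i" and \<phi> = "\<lambda>h. link_value i (good_links i h)" and K = K])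
    show "quiet i h'" if "quiet i h" "h' \<in> set_pmf (period P g (trigger 0) h)" for h h'
      using dev_quiet_step[OF that(1), of h' "trigger 0 i"] that(2) by simp
  qed (use trigger_step assms K in auto)
qed

lemma deviation_payoff_le:
  assumes "quiet i h"
  shows "continuation_payoff P g ((trigger 0)(i := \<tau>)) i h \<le> link_value i (good_links i h)"
proof -
  obtain K where K: "\<And>T. \<bar>link_value i T\<bar> \<le> K" using bounded_value by blast
  show ?thesis
    by (rule continuation_payoff_le[where Inv = "quiet i" and \<phi> = "\<lambda>h. link_value i (good_links i h)" and K = K])
       (use dev_step_le dev_quiet_step assms K in auto)
qed

lemma action_optimal:
  assumes quiet: "quiet i h" "quiet_decisions i d" and ri: "{r, i} \<in> prune (current_network g h) d"
  shows "action_payoff P g ((trigger 0)(i := \<tau>)) i r h d \<le> action_payoff P g (trigger 0) i r h d"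
proof -
  \<comment> \<open>Here \<open>d\<close> is not drawn from the equilibrium but any quiet decision:
    a broken link may have survived because both sides erred. Hence \<open>T\<close> has to exclude
    broken links explicitly.\<close>
  define T where "T = {j \<in> neighbors (prune (current_network g h) d) i. clean h i j}"
  define V where "V x = period_payoff P i (Some (r, i, x)) +
      \<delta> * link_value i (good_links i (h @ [(d, Some (r, i, x))]))" for x
  have "i \<noteq> r" using network_irrefl_prune[OF ri] by simp
  have q: "quiet i (h @ [(d, Some (r, i, x))])" for x
    using quiet by (simp add: quiet_snoc quiet_interaction_def)
  have VP: "V Provide = - c + \<delta> * link_value i T"
    using \<open>i \<noteq> r\<close> by (simp add: V_def good_links_snoc T_def period_payoff_def)
  have "good_links i (h @ [(d, Some (r, i, Refuse))]) = T - {r}"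
    by (auto simp: good_links_snoc T_def doubleton_eq_iff)
  then have VR: "V Refuse = - \<gamma> + \<delta> * link_value i (T - {r})"
    by (simp add: V_def period_payoff_def)
  have best: "V x \<le> V (if clean h i r then Provide else Refuse)" for x
  proof (cases "clean h i r")
    case True
    have "c - \<gamma> \<le> \<delta> * (link_value i T - link_value i (T - {r}))"
    proof (rule value_gain)
      show "r \<in> T" using ri True by (simp add: T_def neighbors_def insert_commute)
      show "T \<subseteq> neighbors g i" using neighbors_prune_subset[OF quiet(1)] by (auto simp: T_def)
    qed
    then show ?thesis using True VP VR by (cases x) (auto simp: algebra_simps)
  next
    case False
    \<comment> \<open>A broken link contributes nothing to the future, so only the current cost
      counts and refusing at \<open>\<gamma> < c\<close> is better.\<close>
    then have "T - {r} = T" by (auto simp: T_def)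
    then show ?thesis using False VP VR params_simps by (cases x) auto
  qed
  have "action_payoff P g ((trigger 0)(i := \<tau>)) i r h d
      \<le> measure_pmf.expectation (snd (\<tau> (private_history g i h) r)) V"
    unfolding action_payoff_def V_def fun_upd_same
    using params_simps by (intro expectation_mono_finite add_left_mono mult_left_mono deviation_payoff_le q) auto
  also have "\<dots> \<le> V (if clean h i r then Provide else Refuse)"
    by (intro expectation_le_const best) simp
  also have "\<dots> = action_payoff P g (trigger 0) i r h d"
    using \<open>i \<noteq> r\<close> by (simp add: action_payoff_def V_def trigger_0_eq trigger_payoff[OF q])
  finally show ?thesis .
qed

lemma trigger_stable: "stable_bilateral_equilibrium P g (trigger 0)"
proof -
  obtain \<mu> \<nu> where cons: "consistent P g (trigger 0) \<mu> \<nu>"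
    and \<mu>: "\<forall>i. \<forall>h\<in>histories P g. \<forall>x\<in>set_pmf (\<mu> i (private_history g i h)).
      length x = length h \<and> quiet i x"
    and \<nu>: "\<forall>i r. \<forall>(h, d)\<in>action_nodes P g i r.
      \<forall>(x, d')\<in>set_pmf (\<nu> i (private_history g i h) (\<lambda>j. d (i, j)) r).
      length x = length h \<and> quiet i x \<and> quiet_decisions i d' \<and> {r, i} \<in> prune (current_network g x) d'"
    by (rule beliefs_exist)
  have "sequentially_rational P g (trigger 0) \<mu> \<nu>"
    unfolding sequentially_rational_def Let_def
  proof (intro conjI allI ballI)
    fix i h \<tau> assume h: "h \<in> histories P g"
    show "measure_pmf.expectation (\<mu> i (private_history g i h)) (continuation_payoff P g ((trigger 0)(i := \<tau>)) i)
      \<le> measure_pmf.expectation (\<mu> i (private_history g i h)) (continuation_payoff P g (trigger 0) i)"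
    proof (rule expectation_mono_finite)
      \<comment> \<open>Beliefs charge only histories of the observed length, of which there are
        finitely many; this supplies integrability for the comparison of expectations.\<close>
      show "finite (set_pmf (\<mu> i (private_history g i h)))"
        by (rule finite_subset[OF _ finite_histories_length[of "length h"]]) (use \<mu> h in auto)
      fix x assume "x \<in> set_pmf (\<mu> i (private_history g i h))"
      then have "quiet i x" using \<mu> h by blast
      then show "continuation_payoff P g ((trigger 0)(i := \<tau>)) i x \<le> continuation_payoff P g (trigger 0) i x"
        using deviation_payoff_le trigger_payoff by simp
    qed
  next
    fix i r y assume hd: "y \<in> action_nodes P g i r"
    obtain h d where [simp]: "y = (h, d)" by (cases y)
    let ?B = "\<nu> i (private_history g i h) (\<lambda>j. d (i, j)) r"
    have \<nu>': "length x = length h \<and> quiet i x \<and> quiet_decisions i d' \<and> {r, i} \<in> prune (current_network g x) d'"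
      if "(x, d') \<in> set_pmf ?B" for x d'
      using \<nu> hd that by fastforce
    have "measure_pmf.expectation ?B (\<lambda>(h', d'). action_payoff P g ((trigger 0)(i := \<tau>)) i r h' d')
        \<le> measure_pmf.expectation ?B (\<lambda>(h', d'). action_payoff P g (trigger 0) i r h' d')" for \<tau>
    proof (rule expectation_mono_finite)
      show "finite (set_pmf ?B)"
      proof (rule finite_subset)
        show "set_pmf ?B \<subseteq> {x. length x = length h} \<times> UNIV" using \<nu>' by auto
        show "finite ({x :: 'n history. length x = length h} \<times> (UNIV :: 'n decisions set))"
          using finite_histories_length by simp
      qed
      fix z assume "z \<in> set_pmf ?B"
      then show "(case z of (h', d') \<Rightarrow> action_payoff P g ((trigger 0)(i := \<tau>)) i r h' d')
          \<le> (case z of (h', d') \<Rightarrow> action_payoff P g (trigger 0) i r h' d')"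
        using \<nu>' by (cases z) (auto intro!: action_optimal)
    qed
    then show "case y of (h, d) \<Rightarrow> \<forall>\<tau>.
        measure_pmf.expectation (\<nu> i (private_history g i h) (\<lambda>j. d (i, j)) r)
          (\<lambda>(h', d'). action_payoff P g ((trigger 0)(i := \<tau>)) i r h' d')
        \<le> measure_pmf.expectation (\<nu> i (private_history g i h) (\<lambda>j. d (i, j)) r)
          (\<lambda>(h', d'). action_payoff P g (trigger 0) i r h' d')" by simp
  qed
  then have "sequential_equilibrium P g (trigger 0) \<mu> \<nu>"
    using cons by (simp add: sequential_equilibrium_def)
  moreover have "bilaterally_measurable P g (trigger 0)"
    by (simp add: bilaterally_measurable_def trigger_def)
  ultimately have "bilateral_equilibrium P g (trigger 0)"
    unfolding bilateral_equilibrium_def by blast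
  then show ?thesis
    unfolding stable_bilateral_equilibrium_def using trigger_on_path by blast
qed

end

theorem proposition2:
  fixes P :: "'f favor_params" and g :: "'n::finite set set"
  assumes "valid_params TYPE('n) P"
    and "network g"
  shows "stable_network P g \<longleftrightarrow> (\<forall>e\<in>g. sustainable P g e)"
proof
  interpret favor_exchange P g by unfold_locales fact+
  show "\<forall>e\<in>g. sustainable P g e" if stable: "stable_network P g"
  proof -
    obtain \<sigma> where "stable_bilateral_equilibrium P g \<sigma>"
      using stable by (auto simp: stable_network_def)
    then interpret stable_profile P g \<sigma> by unfold_locales
    show ?thesis using stable_links_sustainable by blast
  qed
  show "stable_network P g" if "\<forall>e\<in>g. sustainable P g e"
  proof -
    interpret sustainable_network P g by unfold_locales fact
    show ?thesis using trigger_stable by (auto simp: stable_network_def)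
  qed
qed

end
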